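(* Let $X$ be a real Banach space whose norm is octahedral. Let $I$ be an infinite set with $\operatorname{card}(I)>\operatorname{dens}(X^{**})$ and let $2<p<\infty$. Then the norm of the injective tensor product $\ell_p(I)\widehat{\otimes}_\varepsilon X$ is octahedral, but there is no $T\in (\ell_p(I)\widehat{\otimes}_\varepsilon X)^{**}$ such that $\Vert T\Vert=1$ and such that $$\Vert T+S\Vert=1+\Vert S\Vert$$ for every $S\in \ell_p(I)\widehat{\otimes}_\varepsilon X$.
   Context: All Banach spaces are real. $B_X$ and $S_X$ denote the closed unit ball and the unit sphere of $X$; $\operatorname{dens}(X)$ denotes the density character of $X$ (least cardinality of a dense subset). A Banach space is regarded as a subspace of its bidual through the canonical embedding. The norm of a Banach space $X$ is octahedral if for every $n\in\mathbb N$, every $x_1,\ldots,x_n\in S_X$ and every $\varepsilon>0$ there is $x\in B_X$ such that $\Vert x+x_i\Vert>2-\varepsilon$ for every $1\leq i\leq n$. $X\widehat{\otimes}_\varepsilon Y$ denotes the (completed) injective tensor product. *)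

theory Defs
  imports "HOL-Analysis.Analysis"
begin

unbundle cardinal_syntax

type_synonym 'a dual = "'a \<Rightarrow>\<^sub>L real"
type_synonym 'a bidual = "('a \<Rightarrow>\<^sub>L real) \<Rightarrow>\<^sub>L real"

definition bidual_embed :: "'a::real_normed_vector \<Rightarrow> 'a bidual"
  where "bidual_embed x = Blinfun (\<lambda>f. blinfun_apply f x)"

lemma bidual_embed_apply [simp]: "blinfun_apply (bidual_embed x) f = blinfun_apply f x"
  unfolding bidual_embed_def
  by (subst bounded_linear_Blinfun_apply) (auto intro: bounded_linear_intros)

definition octahedral :: "'a::real_normed_vector itself \<Rightarrow> bool"
  where "octahedral _ \<longleftrightarrow>
    (\<forall>(n::nat) (x::nat \<Rightarrow> 'a) (\<epsilon>::real).
       (\<forall>i\<in>{1..n}. x i \<in> sphere 0 1) \<and> \<epsilon> > 0 \<longrightarrow>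
       (\<exists>y\<in>cball 0 1. \<forall>i\<in>{1..n}. norm (y + x i) > 2 - \<epsilon>))"

text \<open>The least cardinality is attained, and the choice of \<open>D\<close> is immaterial: any two choices
  give cardinal orders that are isomorphic, hence equivalent for \<open><o\<close>.\<close>

definition density_character :: "'a::topological_space itself \<Rightarrow> 'a rel"
  where "density_character _ =
    (SOME r. \<exists>D. r = |D| \<and> closure D = UNIV \<and>
       (\<forall>D'::'a set. closure D' = UNIV \<longrightarrow> |D| \<le>o |D'| ))"

lemma density_character_ex:
  "\<exists>D::'a::topological_space set. density_character TYPE('a) = |D| \<and> closure D = UNIV \<and>
       (\<forall>D'::'a set. closure D' = UNIV \<longrightarrow> |D| \<le>o |D'| )"
proof -
  let ?R = "{ |D| | D::'a set. closure D = UNIV}"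
  have "?R \<noteq> {}"
    using closure_UNIV by blast
  moreover have "\<forall>r\<in>?R. Card_order r"
    using card_of_Card_order by blast
  ultimately obtain r where "r \<in> ?R" "\<forall>r'\<in>?R. r \<le>o r'"
    using exists_minim_Card_order[of ?R] by blast
  then have "\<exists>r. \<exists>D::'a set. r = |D| \<and> closure D = UNIV \<and>
       (\<forall>D'::'a set. closure D' = UNIV \<longrightarrow> |D| \<le>o |D'| )"
    by blast
  then show ?thesis
    unfolding density_character_def by (rule someI_ex)
qed

definition lp_space :: "'i set \<Rightarrow> real \<Rightarrow> ('i \<Rightarrow> real) set"
  where "lp_space I p = {f. (\<forall>i. i \<notin> I \<longrightarrow> f i = 0) \<and> (\<lambda>i. \<bar>f i\<bar> powr p) summable_on I}"

definition lp_norm :: "'i set \<Rightarrow> real \<Rightarrow> ('i \<Rightarrow> real) \<Rightarrow> real"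
  where "lp_norm I p f = (\<Sum>\<^sub>\<infinity>i\<in>I. \<bar>f i\<bar> powr p) powr (1 / p)"

text \<open>A type cannot depend on the real number \<open>p\<close>.  The space $\ell_p(I)$ is therefore given as a
  Banach space type \<open>'l\<close> together with a linear isometry \<open>U\<close> of \<open>'l\<close> onto \<^term>\<open>lp_space I p\<close>
  with norm \<^term>\<open>lp_norm I p\<close>; the bijection \<open>U\<close> lists the coordinates of an element.\<close>

definition is_lp_space :: "'i set \<Rightarrow> real \<Rightarrow> ('l::real_normed_vector \<Rightarrow> 'i \<Rightarrow> real) \<Rightarrow> bool"
  where "is_lp_space I p U \<longleftrightarrow>
    (\<forall>x y. U (x + y) = (\<lambda>i. U x i + U y i)) \<and>
    (\<forall>c x. U (c *\<^sub>R x) = (\<lambda>i. c * U x i)) \<and>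
    bij_betw U UNIV (lp_space I p) \<and>
    (\<forall>x. norm x = lp_norm I p (U x))"

text \<open>The algebraic tensor product of \<open>X\<close> and \<open>Y\<close> is the span of the elementary tensors in the
  space of bounded bilinear forms on \<open>X\<^sup>* \<times> Y\<^sup>*\<close>, where \<open>x \<otimes> y\<close> is the form
  \<open>(f, g) \<mapsto> f x * g y\<close>.  The norm of a bilinear form is its supremum over the product of the dual
  unit balls, so on this span it is the injective norm (lemma \<open>norm_inj_tensor_sum\<close> below).
  The space of bilinear forms is complete, so the completion is the closure of the span.\<close>

definition elem_tensor ::
    "'a::real_normed_vector \<Rightarrow> 'b::real_normed_vector \<Rightarrow> 'a dual \<Rightarrow>\<^sub>L 'b bidual"
  where "elem_tensor x y = Blinfun (\<lambda>f. blinfun_apply f x *\<^sub>R bidual_embed y)"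

lemma elem_tensor_apply [simp]:
  "blinfun_apply (blinfun_apply (elem_tensor x y) f) g = blinfun_apply f x * blinfun_apply g y"
  unfolding elem_tensor_def
  by (subst bounded_linear_Blinfun_apply) (auto intro: bounded_linear_intros simp: scaleR_blinfun.rep_eq)

definition inj_tensor_carrier ::
    "('a::real_normed_vector dual \<Rightarrow>\<^sub>L 'b::real_normed_vector bidual) set"
  where "inj_tensor_carrier = closure (span {elem_tensor x y | x y. True})"

lemma closure_span_add:
  fixes A :: "'a::real_normed_vector set"
  assumes "x \<in> closure (span A)" "y \<in> closure (span A)"
  shows "x + y \<in> closure (span A)"
proof -
  obtain f g where "\<forall>n. f n \<in> span A" "f \<longlonglongrightarrow> x" "\<forall>n. g n \<in> span A" "g \<longlonglongrightarrow> y"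
    using assms unfolding closure_sequential by blast
  then have "\<forall>n. f n + g n \<in> span A" "(\<lambda>n. f n + g n) \<longlonglongrightarrow> x + y"
    by (auto intro: span_add tendsto_add)
  then show ?thesis
    unfolding closure_sequential by (intro exI[of _ "\<lambda>n. f n + g n"]) auto
qed

lemma closure_span_scale:
  fixes A :: "'a::real_normed_vector set"
  assumes "x \<in> closure (span A)"
  shows "c *\<^sub>R x \<in> closure (span A)"
proof -
  obtain f where "\<forall>n. f n \<in> span A" "f \<longlonglongrightarrow> x"
    using assms unfolding closure_sequential by blast
  then have "\<forall>n. c *\<^sub>R f n \<in> span A" "(\<lambda>n. c *\<^sub>R f n) \<longlonglongrightarrow> c *\<^sub>R x"
    by (auto intro: span_scale tendsto_intros)
  then show ?thesis
    unfolding closure_sequential by (intro exI[of _ "\<lambda>n. c *\<^sub>R f n"]) auto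
qed

lemma inj_tensor_carrier_add:
  "x \<in> inj_tensor_carrier \<Longrightarrow> y \<in> inj_tensor_carrier \<Longrightarrow> x + y \<in> inj_tensor_carrier"
  unfolding inj_tensor_carrier_def by (rule closure_span_add)

lemma inj_tensor_carrier_scale: "x \<in> inj_tensor_carrier \<Longrightarrow> c *\<^sub>R x \<in> inj_tensor_carrier"
  unfolding inj_tensor_carrier_def by (rule closure_span_scale)

lemma inj_tensor_carrier_0: "0 \<in> inj_tensor_carrier"
  unfolding inj_tensor_carrier_def by (meson closure_subset span_zero subsetD)

typedef (overloaded) ('a, 'b) inj_tensor =
  "inj_tensor_carrier :: ('a::real_normed_vector dual \<Rightarrow>\<^sub>L 'b::real_normed_vector bidual) set"
  morphisms form_of Abs_inj_tensor
  using inj_tensor_carrier_0 by blast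

setup_lifting type_definition_inj_tensor

instantiation inj_tensor :: (real_normed_vector, real_normed_vector) real_normed_vector
begin

lift_definition zero_inj_tensor :: "('a, 'b) inj_tensor" is 0
  by (rule inj_tensor_carrier_0)

lift_definition plus_inj_tensor ::
    "('a, 'b) inj_tensor \<Rightarrow> ('a, 'b) inj_tensor \<Rightarrow> ('a, 'b) inj_tensor" is "(+)"
  by (rule inj_tensor_carrier_add)

lift_definition scaleR_inj_tensor ::
    "real \<Rightarrow> ('a, 'b) inj_tensor \<Rightarrow> ('a, 'b) inj_tensor" is "scaleR"
  by (rule inj_tensor_carrier_scale)

lift_definition uminus_inj_tensor ::
    "('a, 'b) inj_tensor \<Rightarrow> ('a, 'b) inj_tensor" is "uminus"
  by (metis inj_tensor_carrier_scale scaleR_minus1_left)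

lift_definition minus_inj_tensor ::
    "('a, 'b) inj_tensor \<Rightarrow> ('a, 'b) inj_tensor \<Rightarrow> ('a, 'b) inj_tensor" is "(-)"
  by (metis diff_conv_add_uminus inj_tensor_carrier_add inj_tensor_carrier_scale scaleR_minus1_left)

lift_definition norm_inj_tensor :: "('a, 'b) inj_tensor \<Rightarrow> real" is norm .

definition dist_inj_tensor :: "('a, 'b) inj_tensor \<Rightarrow> ('a, 'b) inj_tensor \<Rightarrow> real"
  where "dist_inj_tensor u v = norm (u - v)"

definition sgn_inj_tensor :: "('a, 'b) inj_tensor \<Rightarrow> ('a, 'b) inj_tensor"
  where "sgn_inj_tensor u = scaleR (inverse (norm u)) u"

definition [code del]:
  "(uniformity :: (('a, 'b) inj_tensor \<times> ('a, 'b) inj_tensor) filter) =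
    (INF e\<in>{0 <..}. principal {(x, y). dist x y < e})"

definition open_inj_tensor :: "('a, 'b) inj_tensor set \<Rightarrow> bool"
  where [code del]:
    "open_inj_tensor S = (\<forall>x\<in>S. \<forall>\<^sub>F (x', y) in uniformity. x' = x \<longrightarrow> y \<in> S)"

instance
  apply standard
  unfolding dist_inj_tensor_def open_inj_tensor_def sgn_inj_tensor_def uniformity_inj_tensor_def
  by (rule refl | (transfer, simp add: algebra_simps norm_triangle_ineq))+

end

instance inj_tensor :: (real_normed_vector, real_normed_vector) banach
proof
  fix X :: "nat \<Rightarrow> ('a, 'b) inj_tensor"
  assume X: "Cauchy X"
  have d: "dist (form_of u) (form_of v) = dist u v" for u v :: "('a, 'b) inj_tensor"
    unfolding dist_norm by transfer simp
  have "Cauchy (\<lambda>n. form_of (X n))"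
    using X unfolding Cauchy_def d .
  then obtain L where L: "(\<lambda>n. form_of (X n)) \<longlonglongrightarrow> L"
    using Cauchy_convergent_iff convergent_def by blast
  have "L \<in> inj_tensor_carrier"
    using closed_sequentially[of inj_tensor_carrier, OF _ _ L] form_of
    unfolding inj_tensor_carrier_def by blast
  then obtain u where "L = form_of u"
    using form_of_cases by blast
  then have "X \<longlonglongrightarrow> u"
    using L unfolding tendsto_iff by (simp add: d)
  then show "convergent X"
    by (rule convergentI)
qed

lift_definition tensor ::
    "'a::real_normed_vector \<Rightarrow> 'b::real_normed_vector \<Rightarrow> ('a, 'b) inj_tensor" is elem_tensor
proof -
  fix x :: 'a and y :: 'b
  show "elem_tensor x y \<in> inj_tensor_carrier"
    unfolding inj_tensor_carrier_def
    by (intro subsetD[OF closure_subset] span_base) blast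
qed

lemma norm_bilinear_form_eq_SUP:
  fixes B :: "'a::real_normed_vector \<Rightarrow>\<^sub>L 'b::real_normed_vector \<Rightarrow>\<^sub>L real"
  shows "norm B = (SUP (f, g)\<in>cball 0 1 \<times> cball 0 1. \<bar>blinfun_apply (blinfun_apply B f) g\<bar>)"
proof -
  let ?b = "\<lambda>f g. \<bar>blinfun_apply (blinfun_apply B f) g\<bar>"
  let ?S = "SUP (f, g)\<in>cball 0 1 \<times> cball 0 1. ?b f g"
  have le: "?b f g \<le> norm B * norm f * norm g" for f g
  proof -
    have "?b f g \<le> norm (blinfun_apply B f) * norm g"
      using norm_blinfun[of "blinfun_apply B f" g] by simp
    also have "\<dots> \<le> norm B * norm f * norm g"
      by (intro mult_right_mono norm_blinfun norm_ge_zero)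
    finally show ?thesis .
  qed
  have le1: "?b f g \<le> norm B" if "norm f \<le> 1" "norm g \<le> 1" for f g
  proof -
    have "norm B * norm f * norm g \<le> norm B * 1 * 1"
      using that by (intro mult_mono) auto
    then show ?thesis using le[of f g] by simp
  qed
  have bdd: "bdd_above ((\<lambda>(f, g). ?b f g) ` (cball 0 1 \<times> cball 0 1))"
    by (rule bdd_aboveI[of _ "norm B"]) (auto intro: le1)
  have S: "?b f g \<le> ?S" if "norm f \<le> 1" "norm g \<le> 1" for f g
    using cSUP_upper[OF _ bdd, of "(f, g)"] that by simp
  have S0: "0 \<le> ?S"
    using S[of 0 0] by simp
  have S': "?b f g \<le> ?S * norm f * norm g" for f g
  proof (cases "f = 0 \<or> g = 0")
    case True
    then show ?thesis by auto
  next
    case False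
    have "?b (f /\<^sub>R norm f) (g /\<^sub>R norm g) \<le> ?S"
      using False by (intro S) auto
    moreover have "?b (f /\<^sub>R norm f) (g /\<^sub>R norm g) = ?b f g / (norm f * norm g)"
      by (simp add: blinfun.scaleR_right scaleR_blinfun.rep_eq abs_mult field_simps)
    ultimately show ?thesis
      using False by (simp add: divide_le_eq mult.assoc)
  qed
  have "norm B \<le> ?S"
    by (intro norm_blinfun_bound S0) (use S' S0 in auto)
  moreover have "?S \<le> norm B"
    by (rule cSUP_least) (auto intro: le1)
  ultimately show ?thesis by simp
qed

lemma form_of_sum: "form_of (\<Sum>k\<in>K. u k) = (\<Sum>k\<in>K. form_of (u k))"
  by (induction K rule: infinite_finite_induct)
     (simp_all add: zero_inj_tensor.rep_eq plus_inj_tensor.rep_eq)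

lemma norm_inj_tensor_sum:
  fixes x :: "'k \<Rightarrow> 'a::real_normed_vector" and y :: "'k \<Rightarrow> 'b::real_normed_vector"
  shows "norm (\<Sum>k\<in>K. tensor (x k) (y k)) =
    (SUP (f, g)\<in>cball (0::'a dual) 1 \<times> cball (0::'b dual) 1.
       \<bar>\<Sum>k\<in>K. blinfun_apply f (x k) * blinfun_apply g (y k)\<bar>)"
proof -
  have "blinfun_apply (blinfun_apply (form_of (\<Sum>k\<in>K. tensor (x k) (y k))) f) g =
      (\<Sum>k\<in>K. blinfun_apply f (x k) * blinfun_apply g (y k))" for f g
    unfolding form_of_sum by (simp add: blinfun.sum_left tensor.rep_eq)
  then show ?thesis
    unfolding norm_inj_tensor.rep_eq norm_bilinear_form_eq_SUP by simp
qed

end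

theory Submission
  imports Defs
begin

text \<open>Put \<open>q = p / (p - 1)\<close>, so that \<open>1 < q < 2\<close>, and read an element of the tensor product as an
  operator from \<open>\<ell>\<^sub>p(I)\<^sup>*\<close>, that is from \<open>\<ell>\<^sub>q(I)\<close>, into \<open>X\<close>.

  Octahedrality.  Let \<open>z\<^sub>1, \<dots>, z\<^sub>n\<close> be operators of norm one and let \<open>f\<^sub>i\<close> be a point of the unit ball at
  which \<open>z\<^sub>i\<close> almost attains its norm.  It suffices to find a contraction \<open>S\<close> that almost preserves the
  norm of each \<open>f\<^sub>i\<close> and for which the norm of \<open>S f\<^sub>i + z\<^sub>i f\<^sub>i\<close> is almost the sum of the two norms.
  Octahedrality of \<open>X\<close>, used once for each coordinate, yields the second property for any \<open>S\<close> that
  factors through some \<open>\<ell>\<^sub>1\<^sup>N\<close>, with the unit vectors of \<open>\<ell>\<^sub>1\<^sup>N\<close> sent to suitable vectors of the unit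
  ball of \<open>X\<close> (\<open>octahedral_l1_sum\<close>).  So what is needed is an almost isometric embedding of a
  finite-dimensional \<open>\<ell>\<^sub>q\<^sup>J\<close> into some \<open>\<ell>\<^sub>1\<^sup>N\<close> (\<open>lq_almost_isometric_in_l1\<close>), which exists because
  \<open>q < 2\<close>.  Behind it stand the \<open>q\<close>-stable laws: \<open>exp (- |a|\<^sub>q\<^sup>q)\<close> is a limit of finite sums of
  cosines of linear forms with nonnegative weights; and the integral over \<open>t > 0\<close> of \<open>(1 - g (t a)) / t\<^sup>2\<close> is
  a multiple of \<open>|x|\<close> when \<open>g\<close> is the cosine of the linear form \<open>x\<close>, and a multiple of \<open>|a|\<^sub>q\<close> when
  \<open>g\<close> is \<open>exp (- |a|\<^sub>q\<^sup>q)\<close>.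

  The bidual.  Suppose that \<open>T\<close> has norm one and \<open>|T + S| = 1 + |S|\<close> for every \<open>S\<close>.  Each coordinate
  \<open>i\<close> gives a slice \<open>T\<^sub>i\<close> in \<open>X\<^sup>*\<^sup>*\<close>.  A functional on the tensor product that is almost normed by
  \<open>e\<^sub>i \<otimes> x\<close> is almost zero on everything that vanishes at \<open>i\<close>, because the tensor product inherits from \<open>\<ell>\<^sub>p\<close> an
  upper \<open>p\<close>-estimate (\<open>upper_p_estimate\<close>); hence the equation with \<open>S = e\<^sub>i \<otimes> x\<close> forces
  \<open>|T\<^sub>i| \<ge> 1\<close> (\<open>norm_slice_coord_ge\<close>).  There are more coordinates than the density character of
  \<open>X\<^sup>*\<^sup>*\<close>, so infinitely many slices are within \<open>1/4\<close> of one vector, and \<open>n\<close> of these have a sum of norm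
  at least \<open>n / 2\<close>.  But a sum of \<open>n\<close> slices has norm at most \<open>n powr (1 - 1 / p)\<close>
  (\<open>norm_sum_slices_le\<close>), which is smaller than \<open>n / 2\<close> for large \<open>n\<close>.\<close>

section \<open>Norming functionals\<close>

text \<open>The Hahn-Banach theorem is proved in the form \<open>a minimal sublinear function is linear\<close>: minimal
  functions exist by Zorn's lemma, and they are odd because otherwise they could be lowered.\<close>

definition sublinear_le_norm :: "('a::real_normed_vector \<Rightarrow> real) \<Rightarrow> bool"
  where "sublinear_le_norm p \<longleftrightarrow>
    (\<forall>x y. p (x + y) \<le> p x + p y) \<and> (\<forall>c x. 0 \<le> c \<longrightarrow> p (c *\<^sub>R x) \<le> c * p x) \<and> (\<forall>x. p x \<le> norm x)"

lemma sublinear_le_normD: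
  assumes "sublinear_le_norm p"
  shows "p (x + y) \<le> p x + p y" "0 \<le> c \<Longrightarrow> p (c *\<^sub>R x) \<le> c * p x" "p x \<le> norm x"
    "p 0 = 0" "- p (- x) \<le> p x" "- norm x \<le> p x"
proof -
  show A: "p (x + y) \<le> p x + p y" "0 \<le> c \<Longrightarrow> p (c *\<^sub>R x) \<le> c * p x" "p x \<le> norm x" for x y c
    using assms unfolding sublinear_le_norm_def by auto
  show Z: "p 0 = 0"
    using A(1)[of 0 0] A(2)[of 0 0] by simp
  show "- p (- x) \<le> p x"
    using A(1)[of x "- x"] Z by simp
  then show "- norm x \<le> p x"
    using A(3)[of "- x"] by simp
qed

text \<open>A sublinear \<open>p\<close> is linear if \<open>p (- y) = - p y\<close> for all \<open>y\<close>.  This infimum lowers \<open>p\<close> to a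
  sublinear function that satisfies the equation for the given \<open>y\<close>.\<close>

definition directional_inf :: "('a::real_normed_vector \<Rightarrow> real) \<Rightarrow> 'a \<Rightarrow> 'a \<Rightarrow> real"
  where "directional_inf p y v = (INF t\<in>{0..}. p (v + t *\<^sub>R y) - t * p y)"

lemma
  assumes p: "sublinear_le_norm p"
  shows sublinear_directional_inf: "sublinear_le_norm (directional_inf p y)"
    and directional_inf_le: "directional_inf p y v \<le> p v"
    and directional_inf_minus: "directional_inf p y (- y) \<le> - p y"
proof -
  have "- norm v \<le> p (v + t *\<^sub>R y) - t * p y" if "0 \<le> t" for t v
  proof -
    have "p (t *\<^sub>R y) \<le> p (v + t *\<^sub>R y) + p (- v)"
      using sublinear_le_normD(1)[OF p, of "v + t *\<^sub>R y" "- v"] by simp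
    moreover have "t * p y \<le> p (t *\<^sub>R y)"
    proof (cases "t = 0")
      case True then show ?thesis using sublinear_le_normD(4)[OF p] by simp
    next
      case False
      then have "p (inverse t *\<^sub>R (t *\<^sub>R y)) \<le> inverse t * p (t *\<^sub>R y)"
        using that by (intro sublinear_le_normD(2)[OF p]) simp
      then show ?thesis using that False by (simp add: field_simps)
    qed
    ultimately show ?thesis
      using sublinear_le_normD(3)[OF p, of "- v"] by simp
  qed
  then have "bdd_below ((\<lambda>t. p (v + t *\<^sub>R y) - t * p y) ` {0..})" for v
    by (intro bdd_belowI2) auto
  then have L: "0 \<le> t \<Longrightarrow> directional_inf p y v \<le> p (v + t *\<^sub>R y) - t * p y" for t v
    unfolding directional_inf_def by (intro cINF_lower) auto
  have G: "c \<le> directional_inf p y v" if "\<And>t. 0 \<le> t \<Longrightarrow> c \<le> p (v + t *\<^sub>R y) - t * p y" for c v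
    unfolding directional_inf_def using that by (intro cINF_greatest) auto
  show le: "directional_inf p y v \<le> p v" for v
    using L[of 0 v] by simp
  show "directional_inf p y (- y) \<le> - p y"
    using L[of 1 "- y"] sublinear_le_normD(4)[OF p] by simp
  show "sublinear_le_norm (directional_inf p y)"
    unfolding sublinear_le_norm_def
  proof (intro conjI allI impI)
    fix v w
    have "directional_inf p y (v + w) - (p (v + s *\<^sub>R y) - s * p y) \<le> p (w + t *\<^sub>R y) - t * p y"
      if "0 \<le> s" "0 \<le> t" for s t
      using L[of "s + t" "v + w"] sublinear_le_normD(1)[OF p, of "v + s *\<^sub>R y" "w + t *\<^sub>R y"] that
      by (simp add: algebra_simps)
    then have "directional_inf p y (v + w) - (p (v + s *\<^sub>R y) - s * p y) \<le> directional_inf p y w" if "0 \<le> s" for s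
      using that by (intro G) auto
    then have "directional_inf p y (v + w) - directional_inf p y w \<le> directional_inf p y v"
      by (intro G) (simp add: algebra_simps)
    then show "directional_inf p y (v + w) \<le> directional_inf p y v + directional_inf p y w" by simp
  next
    fix c :: real and v assume c: "0 \<le> c"
    show "directional_inf p y (c *\<^sub>R v) \<le> c * directional_inf p y v"
    proof (cases "c = 0")
      case True
      then show ?thesis using L[of 0 0] sublinear_le_normD(4)[OF p] by simp
    next
      case False
      have "directional_inf p y (c *\<^sub>R v) / c \<le> directional_inf p y v"
      proof (rule G)
        fix t :: real assume "0 \<le> t"
        then have "directional_inf p y (c *\<^sub>R v) \<le> p (c *\<^sub>R (v + t *\<^sub>R y)) - (c * t) * p y"
          using L[of "c * t" "c *\<^sub>R v"] c by (simp add: scaleR_add_right)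
        also have "\<dots> \<le> c * p (v + t *\<^sub>R y) - (c * t) * p y"
          using sublinear_le_normD(2)[OF p c] by (intro diff_right_mono)
        finally show "directional_inf p y (c *\<^sub>R v) / c \<le> p (v + t *\<^sub>R y) - t * p y"
          using c False by (simp add: field_simps)
      qed
      then show ?thesis using c False by (simp add: field_simps)
    qed
  next
    fix v show "directional_inf p y v \<le> norm v"
      using le[of v] sublinear_le_normD(3)[OF p, of v] by simp
  qed
qed

text \<open>The pointwise infimum of a chain is sublinear since two members of a chain have a common lower
  bound in it, and it is finite since every member is at least \<open>- norm\<close>.\<close>

lemma exists_minimal_sublinear:
  assumes p0: "sublinear_le_norm p0"
  obtains m where "sublinear_le_norm m" "m \<le> p0" "\<And>q. sublinear_le_norm q \<Longrightarrow> q \<le> m \<Longrightarrow> q = m"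
proof -
  let ?A = "{p. sublinear_le_norm p \<and> p \<le> p0}"
  let ?P = "\<lambda>f g :: 'a \<Rightarrow> real. g \<le> f"
  have po: "partial_order_on ?A (relation_of ?P ?A)"
    unfolding partial_order_on_def preorder_on_def refl_on_def trans_def antisym_def relation_of_def
    by auto
  have ch: "\<exists>u\<in>?A. \<forall>a\<in>C. u \<le> a" if "C \<in> Chains (relation_of ?P ?A)" for C
  proof (cases "C = {}")
    case True then show ?thesis using p0 by auto
  next
    case False
    have CA: "sublinear_le_norm f" "f \<le> p0" if "f \<in> C" for f
      using that \<open>C \<in> _\<close> unfolding Chains_def relation_of_def by auto
    have tot: "f \<le> g \<or> g \<le> f" if "f \<in> C" "g \<in> C" for f g
      using that \<open>C \<in> _\<close> unfolding Chains_def relation_of_def by auto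
    define u where "u v = (INF f\<in>C. f v)" for v
    have "bdd_below ((\<lambda>f. f v) ` C)" for v
      using sublinear_le_normD(6)[OF CA(1)] by (intro bdd_belowI2[of _ "- norm v"]) auto
    then have L: "u v \<le> f v" if "f \<in> C" for f v
      unfolding u_def using that by (intro cINF_lower) auto
    have G: "c \<le> u v" if "\<And>f. f \<in> C \<Longrightarrow> c \<le> f v" for c v
      unfolding u_def using that False by (intro cINF_greatest) auto
    obtain f0 where f0: "f0 \<in> C" using False by blast
    have "sublinear_le_norm u"
      unfolding sublinear_le_norm_def
    proof (intro conjI allI impI)
      fix v w
      have "u (v + w) - f v \<le> g w" if fg: "f \<in> C" "g \<in> C" for f g
      proof -
        obtain h where h: "h \<in> C" "h \<le> f" "h \<le> g"
          using tot[OF fg] fg by auto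
        have "u (v + w) \<le> h v + h w"
          using L[OF h(1)] sublinear_le_normD(1)[OF CA(1)[OF h(1)]] order_trans by blast
        also have "\<dots> \<le> f v + g w"
          using h by (intro add_mono) (auto simp: le_fun_def)
        finally show ?thesis by simp
      qed
      then have "u (v + w) - f v \<le> u w" if "f \<in> C" for f
        using that by (intro G) auto
      then have "u (v + w) - u w \<le> u v"
        by (intro G) (simp add: algebra_simps)
      then show "u (v + w) \<le> u v + u w" by simp
    next
      fix c :: real and v assume c: "0 \<le> c"
      show "u (c *\<^sub>R v) \<le> c * u v"
      proof (cases "c = 0")
        case True
        then show ?thesis using L[OF f0, of 0] sublinear_le_normD(4)[OF CA(1)[OF f0]] by simp
      next
        case False
        have "u (c *\<^sub>R v) / c \<le> u v"
        proof (rule G)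
          fix f assume f: "f \<in> C"
          show "u (c *\<^sub>R v) / c \<le> f v"
            using L[OF f, of "c *\<^sub>R v"] sublinear_le_normD(2)[OF CA(1)[OF f] c, of v] c False
            by (simp add: field_simps)
        qed
        then show ?thesis using c False by (simp add: field_simps)
      qed
    next
      fix v show "u v \<le> norm v"
        using L[OF f0, of v] sublinear_le_normD(3)[OF CA(1)[OF f0], of v] by simp
    qed
    moreover have "u \<le> p0"
      using L[OF f0] CA(2)[OF f0] by (auto simp: le_fun_def intro: order_trans)
    ultimately show ?thesis
      using L by (auto simp: le_fun_def)
  qed
  obtain m where m: "m \<in> ?A" "\<forall>a\<in>?A. a \<le> m \<longrightarrow> a = m"
    using predicate_Zorn[OF po ch] by blast
  show ?thesis
    using m by (intro that[of m]) (auto intro: order_trans)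
qed

text \<open>The starting point \<^term>\<open>directional_inf norm x\<close> is at most \<open>- norm x\<close> at \<open>- x\<close>, and so is every function
  below it; an odd one then has value \<open>norm x\<close> at \<open>x\<close>.\<close>

lemma norming_functional:
  fixes x :: "'a::real_normed_vector"
  obtains f :: "'a dual" where "norm f \<le> 1" "blinfun_apply f x = norm x"
proof -
  have n: "sublinear_le_norm (norm :: 'a \<Rightarrow> real)"
    unfolding sublinear_le_norm_def by (auto intro: norm_triangle_ineq)
  obtain m where m: "sublinear_le_norm m" "m \<le> directional_inf norm x"
    and min: "\<And>q. sublinear_le_norm q \<Longrightarrow> q \<le> m \<Longrightarrow> q = m"
    using exists_minimal_sublinear[OF sublinear_directional_inf[OF n]] by blast
  have odd: "m (- y) = - m y" for y
  proof -
    have "directional_inf m y = m"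
      using sublinear_directional_inf[OF m(1)] directional_inf_le[OF m(1)] by (intro min) (auto simp: le_fun_def)
    then have "m (- y) \<le> - m y"
      using directional_inf_minus[OF m(1), of y] by simp
    then show ?thesis
      using sublinear_le_normD(5)[OF m(1), of y] by simp
  qed
  have add: "m (v + w) = m v + m w" for v w
    using sublinear_le_normD(1)[OF m(1), of v w] sublinear_le_normD(1)[OF m(1), of "- v" "- w"]
      odd[of "v + w"] by (simp add: odd)
  have scale0: "m (c *\<^sub>R v) = c * m v" if "0 \<le> c" for c v
    using sublinear_le_normD(2)[OF m(1) that, of v] sublinear_le_normD(2)[OF m(1) that, of "- v"]
    by (simp add: odd)
  have scale: "m (c *\<^sub>R v) = c * m v" for c v
    using scale0[of c v] scale0[of "- c" v] odd[of "c *\<^sub>R v"] by (cases "0 \<le> c") auto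
  have le: "\<bar>m v\<bar> \<le> norm v" for v
    using sublinear_le_normD(3,6)[OF m(1), of v] by (simp add: abs_le_iff)
  have bl: "bounded_linear m"
    by (rule bounded_linear_intro[where K = 1]) (auto simp: add scale le)
  have "m (- x) \<le> - norm x"
    using m(2) directional_inf_minus[OF n, of x] by (auto simp: le_fun_def intro: order_trans)
  then have "m x = norm x"
    using le[of x] by (simp add: odd)
  moreover have "norm (Blinfun m) \<le> 1"
    by (rule norm_blinfun_bound) (auto simp: bounded_linear_Blinfun_apply[OF bl] le)
  ultimately show ?thesis
    by (intro that[of "Blinfun m"]) (simp_all add: bounded_linear_Blinfun_apply[OF bl])
qed

section \<open>Functionals and the canonical embedding\<close>

lemma norm_blinfun_le_of_unit_ball:
  fixes F :: "'a::real_normed_vector \<Rightarrow>\<^sub>L 'b::real_normed_vector"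
  assumes "\<And>x. norm x \<le> 1 \<Longrightarrow> norm (blinfun_apply F x) \<le> c"
  shows "norm F \<le> c"
proof (rule norm_blinfun_bound)
  show "0 \<le> c" using assms[of 0] by simp
  fix x
  show "norm (blinfun_apply F x) \<le> c * norm x"
  proof (cases "x = 0")
    case False
    have "norm (blinfun_apply F (inverse (norm x) *\<^sub>R x)) \<le> c"
      using False by (intro assms) simp
    then show ?thesis
      using False by (simp add: blinfun.scaleR_right field_simps)
  qed simp
qed

lemma norm_dual_le_of_unit_ball:
  fixes f :: "'a::real_normed_vector dual"
  assumes "\<And>x. norm x \<le> 1 \<Longrightarrow> blinfun_apply f x \<le> c"
  shows "norm f \<le> c"
proof (rule norm_blinfun_le_of_unit_ball)
  fix x :: 'a assume "norm x \<le> 1"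
  then show "norm (blinfun_apply f x) \<le> c"
    using assms[of x] assms[of "- x"] by (simp add: blinfun.minus_right)
qed

lemma bidual_embed_add: "bidual_embed (x + y) = bidual_embed x + bidual_embed y"
  and bidual_embed_scale: "bidual_embed (c *\<^sub>R x) = c *\<^sub>R bidual_embed x"
  by (auto intro!: blinfun_eqI simp: blinfun.add_right blinfun.scaleR_right
      blinfun.add_left blinfun.scaleR_left)

lemma span_range_bidual_embed: "span (range (bidual_embed :: 'b::real_normed_vector \<Rightarrow> _)) = range bidual_embed"
proof -
  have "linear (bidual_embed :: 'b \<Rightarrow> _)"
    by (rule linearI) (rule bidual_embed_add bidual_embed_scale)+
  from linear_subspace_image[OF this subspace_UNIV] show ?thesis
    by (simp add: span_eq_iff)
qed

lemma norm_bidual_embed [simp]: "norm (bidual_embed x) = norm x"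
proof (rule antisym)
  show "norm (bidual_embed x) \<le> norm x"
  proof (rule norm_blinfun_bound)
    show "norm (blinfun_apply (bidual_embed x) f) \<le> norm x * norm f" for f
      using norm_blinfun[of f x] by (simp add: mult.commute)
  qed simp
  obtain f :: "'a dual" where f: "norm f \<le> 1" "blinfun_apply f x = norm x"
    using norming_functional by blast
  have "norm x \<le> norm (bidual_embed x) * norm f"
    using norm_blinfun[of "bidual_embed x" f] f by simp
  also have "\<dots> \<le> norm (bidual_embed x)"
    using f(1) by (intro mult_left_le) auto
  finally show "norm x \<le> norm (bidual_embed x)" .
qed

section \<open>Oscillatory integrals on the half-line\<close>

abbreviation halfline_integrable :: "(real \<Rightarrow> real) \<Rightarrow> bool"
  where "halfline_integrable f \<equiv> integrable lborel (\<lambda>u. indicator {0<..} u * f u)"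

abbreviation halfline_integral :: "(real \<Rightarrow> real) \<Rightarrow> real"
  where "halfline_integral f \<equiv> integral\<^sup>L lborel (\<lambda>u. indicator {0<..} u * f u)"

lemma halfline_integral_scale:
  assumes "0 < c"
  shows "halfline_integral (\<lambda>u. f (c * u)) = halfline_integral f / c"
proof -
  have "halfline_integral f = c * halfline_integral (\<lambda>u. f (c * u))"
    using lborel_integral_real_affine[of c "\<lambda>u. indicator {0<..} u * f u" 0] assms
    by (simp add: indicator_def zero_less_mult_iff)
  then show ?thesis using assms by simp
qed

lemma halfline_dominated_convergence:
  fixes s :: "nat \<Rightarrow> real \<Rightarrow> real"
  assumes [measurable]: "f \<in> borel_measurable borel" "\<And>n. s n \<in> borel_measurable borel"
    and w: "halfline_integrable w"
    and lim: "\<And>u. 0 < u \<Longrightarrow> (\<lambda>n. s n u) \<longlonglongrightarrow> f u"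
    and bound: "\<And>n u. 0 < u \<Longrightarrow> \<bar>s n u\<bar> \<le> w u"
  shows "(\<lambda>n. halfline_integral (s n)) \<longlonglongrightarrow> halfline_integral f"
proof (rule integral_dominated_convergence[where w = "\<lambda>u. indicator {0<..} u * w u"])
  show "AE u in lborel. (\<lambda>n. indicator {0<..} u * s n u) \<longlonglongrightarrow> indicator {0<..} u * f u"
  proof (rule AE_I2)
    fix u :: real
    show "(\<lambda>n. indicator {0<..} u * s n u) \<longlonglongrightarrow> indicator {0<..} u * f u"
      using lim[of u] by (cases "0 < u") auto
  qed
  show "AE u in lborel. norm (indicator {0<..} u * s n u) \<le> indicator {0<..} u * w u" for n
    using bound by (intro AE_I2) (auto simp: indicator_def)
qed (use w in auto)

lemma halfline_integrable_bound:
  assumes "halfline_integrable w" "f \<in> borel_measurable borel" "\<And>u. 0 < u \<Longrightarrow> \<bar>f u\<bar> \<le> w u"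
  shows "halfline_integrable f"
  using assms(1)
  by (rule Bochner_Integration.integrable_bound)
     (use assms(2,3) in \<open>auto simp: indicator_def intro: order_trans[OF _ abs_ge_self]\<close>)

lemma halfline_integral_mono:
  assumes "halfline_integrable w" "halfline_integrable f" "\<And>u. 0 < u \<Longrightarrow> f u \<le> w u"
  shows "halfline_integral f \<le> halfline_integral w"
  using assms by (intro integral_mono) (auto simp: indicator_def)

text \<open>All integrands below are dominated by such a minimum: the first power controls them at \<open>0\<close>, the
  second one at infinity.\<close>

lemma halfline_integrable_min_powr:
  fixes A B \<alpha> \<beta> :: real
  assumes "- 1 < \<alpha>" "\<beta> < - 1" "0 \<le> A" "0 \<le> B"
  shows "halfline_integrable (\<lambda>u. min (A * u powr \<alpha>) (B * u powr \<beta>))"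
proof -
  have "set_integrable lebesgue {0..1} (\<lambda>u::real. u powr \<alpha>)"
    using assms by (intro nonnegative_absolutely_integrable_1 integrable_on_powr_from_0) auto
  then have 1: "integrable lborel (\<lambda>u::real. indicator {0..1} u * u powr \<alpha>)"
    unfolding set_integrable_def by (subst (asm) integrable_completion) auto
  have "(\<lambda>u::real. u powr \<beta>) integrable_on {1..}"
    using has_integral_powr_to_inf[of \<beta> 1] assms unfolding integrable_on_def by auto
  then have "set_integrable lebesgue {1..} (\<lambda>u::real. u powr \<beta>)"
    by (intro nonnegative_absolutely_integrable_1) auto
  then have 2: "integrable lborel (\<lambda>u::real. indicator {1..} u * u powr \<beta>)"
    unfolding set_integrable_def by (subst (asm) integrable_completion) auto
  have "integrable lborel (\<lambda>u::real. A * (indicator {0..1} u * u powr \<alpha>)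
      + B * (indicator {1..} u * u powr \<beta>))"
    using 1 2 by (intro Bochner_Integration.integrable_add integrable_mult_right) auto
  then show ?thesis
    by (rule Bochner_Integration.integrable_bound)
       (use assms in \<open>auto simp: indicator_def min_def intro!: AE_I2\<close>)
qed

lemma halfline_integral_pos:
  assumes f: "halfline_integrable f" "\<And>u. 0 < u \<Longrightarrow> 0 \<le> f u"
    and c: "0 < c" "\<And>u. 1 \<le> u \<Longrightarrow> u \<le> 2 \<Longrightarrow> c \<le> f u"
  shows "0 < halfline_integral f"
proof -
  have "c = integral\<^sup>L lborel (\<lambda>u::real. c * indicator {1..2} u)"
    by simp
  also have "\<dots> \<le> halfline_integral f"
    using f c
    by (intro integral_mono integrable_mult_right integrable_real_indicator) (auto simp: indicator_def)
  finally show ?thesis using c by simp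
qed

text \<open>The integral of this function over the half-line is a multiple of \<open>|x| powr r\<close>.  The case
  \<open>r = 1\<close> produces absolute values of linear forms, the case \<open>1 < r < 2\<close> the powers that make up
  an \<open>\<ell>\<^sub>r\<close>-norm.\<close>

definition osc :: "real \<Rightarrow> real \<Rightarrow> real \<Rightarrow> real"
  where "osc r x u = (1 - cos (u * x)) * u powr (- 1 - r)"

definition osc_bound :: "real \<Rightarrow> real \<Rightarrow> real \<Rightarrow> real"
  where "osc_bound r x u = min (x\<^sup>2 / 2 * u powr (1 - r)) (2 * u powr (- 1 - r))"

lemma osc_measurable [measurable]: "osc r x \<in> borel_measurable borel"
  unfolding osc_def by measurable

lemma one_minus_cos_le: "1 - cos y \<le> (y::real)\<^sup>2 / 2"
proof -
  have "\<bar>sin (y / 2)\<bar> \<le> \<bar>y / 2\<bar>" by (rule abs_sin_x_le_abs_x)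
  then have "(sin (y / 2))\<^sup>2 \<le> (y / 2)\<^sup>2"
    using abs_le_square_iff by blast
  moreover have "1 - cos y = 2 * (sin (y / 2))\<^sup>2"
    using cos_double_sin[of "y / 2"] by simp
  ultimately show ?thesis by (simp add: power_divide)
qed

lemma osc_nonneg: "0 \<le> osc r x u"
  unfolding osc_def by simp

lemma osc_le_bound:
  assumes "0 < u"
  shows "osc r x u \<le> osc_bound r x u"
proof -
  have "osc r x u \<le> (u * x)\<^sup>2 / 2 * u powr (- 1 - r)"
    unfolding osc_def by (intro mult_right_mono one_minus_cos_le) auto
  also have "\<dots> = x\<^sup>2 / 2 * u powr (1 - r)"
    using assms powr_add[of u 2 "- 1 - r"] by (simp add: power_mult_distrib)
  finally have "osc r x u \<le> x\<^sup>2 / 2 * u powr (1 - r)" .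
  moreover have "osc r x u \<le> 2 * u powr (- 1 - r)"
    unfolding osc_def using cos_ge_minus_one[of "u * x"] by (intro mult_right_mono) auto
  ultimately show ?thesis unfolding osc_bound_def by simp
qed

lemma osc_bound_integrable:
  assumes "0 < r" "r < 2"
  shows "halfline_integrable (osc_bound r x)"
  unfolding osc_bound_def using assms by (intro halfline_integrable_min_powr) auto

lemma osc_integrable:
  assumes "0 < r" "r < 2"
  shows "halfline_integrable (osc r x)"
  by (rule halfline_integrable_bound[OF osc_bound_integrable[OF assms, of x]])
     (use osc_le_bound osc_nonneg in auto)

lemma osc_abs: "osc r \<bar>x\<bar> u = osc r x u" "osc_bound r \<bar>x\<bar> u = osc_bound r x u"
  unfolding osc_def osc_bound_def by (auto simp: abs_if)

lemma osc_scale: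
  assumes "0 < x" "0 < u"
  shows "osc r x u = x powr (1 + r) * osc r 1 (x * u)"
    and "osc_bound r x u = x powr (1 + r) * osc_bound r 1 (x * u)"
proof -
  have a: "x powr (1 + r) * (x * u) powr (- 1 - r) = u powr (- 1 - r)"
  proof -
    have "x powr (1 + r) * x powr (- 1 - r) = 1"
      using assms by (simp flip: powr_add)
    then show ?thesis
      using assms by (simp add: powr_mult mult.assoc[symmetric])
  qed
  have b: "x powr (1 + r) * (x * u) powr (1 - r) = x\<^sup>2 * u powr (1 - r)"
  proof -
    have "x powr (1 + r) * x powr (1 - r) = x\<^sup>2"
      using assms by (simp flip: powr_add)
    then show ?thesis
      using assms by (simp add: powr_mult mult.assoc[symmetric])
  qed
  show "osc r x u = x powr (1 + r) * osc r 1 (x * u)"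
    unfolding osc_def using a by (simp add: mult.commute mult.left_commute)
  have "x powr (1 + r) * osc_bound r 1 (x * u) =
      min (1/2 * (x powr (1 + r) * (x * u) powr (1 - r))) (2 * (x powr (1 + r) * (x * u) powr (- 1 - r)))"
    unfolding osc_bound_def by (simp add: min_mult_distrib_left mult.left_commute)
  then show "osc_bound r x u = x powr (1 + r) * osc_bound r 1 (x * u)"
    unfolding a b by (simp add: osc_bound_def)
qed

text \<open>The substitution \<open>v = x * u\<close>, which turns a scaling law of an integrand into the homogeneity of its
  integral without evaluating any constant.\<close>

lemma halfline_integral_homogeneous:
  assumes "0 \<le> x" "0 < r" "\<And>u. 0 < u \<Longrightarrow> 0 < x \<Longrightarrow> f x u = x powr (1 + r) * f 1 (x * u)"
    "x = 0 \<Longrightarrow> halfline_integral (f x) = 0"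
  shows "halfline_integral (f x) = x powr r * halfline_integral (f 1)"
proof (cases "x = 0")
  case True then show ?thesis using assms by simp
next
  case False
  then have x: "0 < x" using assms by simp
  have "halfline_integral (f x) = halfline_integral (\<lambda>u. x powr (1 + r) * f 1 (x * u))"
    using x assms(3) by (intro Bochner_Integration.integral_cong) (auto simp: indicator_def)
  also have "\<dots> = x powr (1 + r) * halfline_integral (\<lambda>u. f 1 (x * u))"
    by (subst integral_mult_right_zero[symmetric]) (simp add: mult.left_commute)
  also have "\<dots> = x powr (1 + r) / x * halfline_integral (f 1)"
    using halfline_integral_scale[OF x, of "f 1"] by simp
  also have "x powr (1 + r) / x = x powr r"
    using x by (simp add: powr_add)
  finally show ?thesis .
qed

lemma osc_integral:
  assumes "0 < r" "r < 2"
  shows "halfline_integral (osc r x) = \<bar>x\<bar> powr r * halfline_integral (osc r 1)"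
    and "halfline_integral (osc_bound r x) = \<bar>x\<bar> powr r * halfline_integral (osc_bound r 1)"
proof -
  have "halfline_integral (osc r \<bar>x\<bar>) = \<bar>x\<bar> powr r * halfline_integral (osc r 1)"
    using assms by (intro halfline_integral_homogeneous osc_scale) (auto simp: osc_def)
  then show "halfline_integral (osc r x) = \<bar>x\<bar> powr r * halfline_integral (osc r 1)"
    unfolding osc_abs .
  have "halfline_integral (osc_bound r \<bar>x\<bar>) = \<bar>x\<bar> powr r * halfline_integral (osc_bound r 1)"
    using assms by (intro halfline_integral_homogeneous osc_scale) (auto simp: osc_bound_def)
  then show "halfline_integral (osc_bound r x) = \<bar>x\<bar> powr r * halfline_integral (osc_bound r 1)"
    unfolding osc_abs .
qed

lemma osc_integral_pos:
  assumes "0 < r" "r < 2"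
  shows "0 < halfline_integral (osc r 1)"
proof (rule halfline_integral_pos[where c = "(1 - cos 1) * 2 powr (- 1 - r)"])
  have c1: "cos (1::real) < 1"
    using cos_monotone_0_pi[of 0 1] pi_gt3 by simp
  then show "0 < (1 - cos 1) * 2 powr (- 1 - r)" by simp
  fix u :: real assume u: "1 \<le> u" "u \<le> 2"
  have "cos u \<le> cos 1"
    using cos_monotone_0_pi_le[of 1 u] u pi_gt3 by simp
  moreover have "2 powr (- 1 - r) \<le> u powr (- 1 - r)"
    using u assms by (intro powr_mono2') auto
  ultimately show "(1 - cos 1) * 2 powr (- 1 - r) \<le> osc r 1 u"
    unfolding osc_def using c1 by (intro mult_mono) auto
qed (use osc_integrable[OF assms] osc_nonneg in auto)

text \<open>Right-endpoint Riemann sum for the integral of \<^term>\<open>osc q x\<close>, of mesh \<open>1 / (n + 1)\<close>, over an interval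
  whose length \<open>n + 1\<close> grows with \<open>n\<close>.\<close>

definition osc_sum :: "real \<Rightarrow> nat \<Rightarrow> real \<Rightarrow> real"
  where "osc_sum q n x = (\<Sum>k<(Suc n)\<^sup>2. osc q x (real (Suc k) / real (Suc n)) / real (Suc n))"

text \<open>The point of the grid assigned to \<open>u\<close> is the right end of its cell, so it is at least \<open>u\<close>.  This is
  what lets a decreasing bound for \<open>h\<close> dominate the step function.\<close>

lemma step_function_eq:
  fixes h :: "real \<Rightarrow> real"
  assumes "0 < u"
  shows "(\<Sum>k<(Suc n)\<^sup>2. h (real (Suc k) / real (Suc n)) *
      indicator {real k / real (Suc n)<..real (Suc k) / real (Suc n)} u) =
    (if \<lceil>real (Suc n) * u\<rceil> \<le> int ((Suc n)\<^sup>2) then h (of_int \<lceil>real (Suc n) * u\<rceil> / real (Suc n)) else 0)"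
proof -
  let ?N = "real (Suc n)" and ?c = "\<lceil>real (Suc n) * u\<rceil>"
  have c: "0 < ?c" using assms by simp
  define m where "m = nat (?c - 1)"
  have cm: "?c = int (Suc m)" using c by (simp add: m_def)
  have "indicator {real k / ?N<..real (Suc k) / ?N} u = (if k = m then 1 else (0::real))" for k
  proof -
    have "u \<in> {real k / ?N<..real (Suc k) / ?N} \<longleftrightarrow> real k < ?N * u \<and> ?N * u \<le> real (Suc k)"
      by (simp add: field_simps)
    also have "\<dots> \<longleftrightarrow> ?c = int (Suc k)"
      unfolding ceiling_eq_iff by simp
    finally show ?thesis using cm by (simp add: indicator_def)
  qed
  then have "(\<Sum>k<(Suc n)\<^sup>2. h (real (Suc k) / ?N) * indicator {real k / ?N<..real (Suc k) / ?N} u) =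
      (\<Sum>k<(Suc n)\<^sup>2. if k = m then h (real (Suc m) / ?N) else 0)"
    by (intro sum.cong) auto
  also have "\<dots> = (if m < (Suc n)\<^sup>2 then h (real (Suc m) / ?N) else 0)"
    by simp
  also have "m < (Suc n)\<^sup>2 \<longleftrightarrow> ?c \<le> int ((Suc n)\<^sup>2)"
    unfolding cm of_nat_le_iff by (rule Suc_le_eq[symmetric])
  also have "real (Suc m) = of_int ?c" unfolding cm by simp
  finally show ?thesis .
qed

lemma osc_bound_antimono:
  assumes "1 \<le> q" "0 < u" "u \<le> v"
  shows "osc_bound q x v \<le> osc_bound q x u"
  unfolding osc_bound_def using assms
  by (intro min.mono mult_left_mono powr_mono2') auto

lemma
  assumes q: "1 \<le> q" "q < 2"
  shows osc_sum_tendsto: "(\<lambda>n. osc_sum q n x) \<longlonglongrightarrow> \<bar>x\<bar> powr q * halfline_integral (osc q 1)"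
    and osc_sum_le: "osc_sum q n x \<le> \<bar>x\<bar> powr q * halfline_integral (osc_bound q 1)"
proof -
  \<comment> \<open>The Riemann sum is the integral of a step function, so dominated convergence applies.\<close>
  define s where "s n u = (\<Sum>k<(Suc n)\<^sup>2. osc q x (real (Suc k) / real (Suc n)) *
      indicator {real k / real (Suc n)<..real (Suc k) / real (Suc n)} u)" for n u
  have q0: "0 < q" using q by simp
  have [measurable]: "s n \<in> borel_measurable borel" for n
    unfolding s_def by measurable
  have int: "osc_sum q n x = halfline_integral (s n)" for n
  proof -
    have "s n u = 0" if "u \<le> 0" for u
    proof -
      have "\<not> real k / real (Suc n) < u" for k
        using that by (simp add: not_less order_trans[OF that])
      then show ?thesis unfolding s_def by (intro sum.neutral) auto
    qed
    then have "halfline_integral (s n) = integral\<^sup>L lborel (s n)"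
      by (intro Bochner_Integration.integral_cong refl) (auto simp: indicator_def not_less)
    also have "\<dots> = osc_sum q n x"
      unfolding s_def osc_sum_def
      by (subst Bochner_Integration.integral_sum)
         (auto intro!: integrable_mult_right integrable_real_indicator sum.cong
            simp: diff_divide_distrib[symmetric] divide_right_mono)
    finally show ?thesis by simp
  qed
  have bound: "0 \<le> s n u \<and> s n u \<le> osc_bound q x u" if u: "0 < u" for n u
  proof -
    have "u \<le> of_int \<lceil>real (Suc n) * u\<rceil> / real (Suc n)"
      using le_of_int_ceiling[of "real (Suc n) * u"] by (simp add: field_simps)
    moreover from this have "osc q x (of_int \<lceil>real (Suc n) * u\<rceil> / real (Suc n))
        \<le> osc_bound q x (of_int \<lceil>real (Suc n) * u\<rceil> / real (Suc n))"
      using u by (intro osc_le_bound) linarith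
    ultimately have "osc q x (of_int \<lceil>real (Suc n) * u\<rceil> / real (Suc n)) \<le> osc_bound q x u"
      using osc_bound_antimono[OF q(1) u] order_trans by blast
    moreover have "0 \<le> osc_bound q x u"
      unfolding osc_bound_def by auto
    ultimately show ?thesis
      unfolding s_def step_function_eq[OF u] using osc_nonneg by auto
  qed
  have lim: "(\<lambda>n. s n u) \<longlonglongrightarrow> osc q x u" if u: "0 < u" for u
  proof -
    have "(\<lambda>n. of_int \<lceil>real (Suc n) * u\<rceil> / real (Suc n)) \<longlonglongrightarrow> u"
    proof (rule tendsto_sandwich)
      show "\<forall>\<^sub>F n in sequentially. u \<le> of_int \<lceil>real (Suc n) * u\<rceil> / real (Suc n)"
        using le_of_int_ceiling[of "real (Suc n) * u" for n] by (simp add: field_simps)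
      show "\<forall>\<^sub>F n in sequentially. of_int \<lceil>real (Suc n) * u\<rceil> / real (Suc n) \<le> u + inverse (real (Suc n))"
      proof (rule always_eventually, rule allI)
        fix n
        have "of_int \<lceil>real (Suc n) * u\<rceil> \<le> real (Suc n) * u + 1"
          using of_int_ceiling_le_add_one by blast
        then have "of_int \<lceil>real (Suc n) * u\<rceil> / real (Suc n) \<le> (real (Suc n) * u + 1) / real (Suc n)"
          by (intro divide_right_mono) auto
        also have "\<dots> = u + inverse (real (Suc n))"
          by (simp add: add_divide_distrib inverse_eq_divide)
        finally show "of_int \<lceil>real (Suc n) * u\<rceil> / real (Suc n) \<le> u + inverse (real (Suc n))" .
      qed
      show "(\<lambda>n. u + inverse (real (Suc n))) \<longlonglongrightarrow> u"
        using tendsto_add[OF tendsto_const[of u] LIMSEQ_inverse_real_of_nat] by simp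
    qed auto
    then have "(\<lambda>n. osc q x (of_int \<lceil>real (Suc n) * u\<rceil> / real (Suc n))) \<longlonglongrightarrow> osc q x u"
      unfolding osc_def using u by (intro tendsto_intros) auto
    moreover have "\<forall>\<^sub>F n in sequentially. s n u = osc q x (of_int \<lceil>real (Suc n) * u\<rceil> / real (Suc n))"
    proof -
      have "s n u = osc q x (of_int \<lceil>real (Suc n) * u\<rceil> / real (Suc n))" if "n \<ge> nat \<lceil>u\<rceil>" for n
      proof -
        have "u \<le> real (Suc n)"
          using that by linarith
        then have "real (Suc n) * u \<le> real (Suc n) * real (Suc n)"
          by (intro mult_left_mono) auto
        also have "\<dots> = of_int (int ((Suc n)\<^sup>2))"
          unfolding of_int_of_nat_eq power2_eq_square by (rule of_nat_mult[symmetric])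
        finally have "real (Suc n) * u \<le> of_int (int ((Suc n)\<^sup>2))" .
        then have "\<lceil>real (Suc n) * u\<rceil> \<le> int ((Suc n)\<^sup>2)"
          by (simp only: ceiling_le_iff)
        then show ?thesis unfolding s_def step_function_eq[OF u] by simp
      qed
      then show ?thesis unfolding eventually_sequentially by blast
    qed
    ultimately show ?thesis
      using tendsto_cong by fastforce
  qed
  have "(\<lambda>n. halfline_integral (s n)) \<longlonglongrightarrow> halfline_integral (osc q x)"
  proof (rule halfline_dominated_convergence[OF _ _ osc_bound_integrable[OF q0 q(2), of x] lim])
    show "\<bar>s n u\<bar> \<le> osc_bound q x u" if "0 < u" for n u
      using bound[OF that, of n] by simp
  qed measurable
  then show "(\<lambda>n. osc_sum q n x) \<longlonglongrightarrow> \<bar>x\<bar> powr q * halfline_integral (osc q 1)"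
    unfolding int osc_integral(1)[OF q0 q(2), of x] .
  have "halfline_integral (s n) \<le> halfline_integral (osc_bound q x)"
  proof (rule halfline_integral_mono[OF osc_bound_integrable[OF q0 q(2), of x]])
    show "halfline_integrable (s n)"
    proof (rule halfline_integrable_bound[OF osc_bound_integrable[OF q0 q(2), of x]])
      show "\<bar>s n u\<bar> \<le> osc_bound q x u" if "0 < u" for u
        using bound[OF that, of n] by simp
    qed measurable
    show "s n u \<le> osc_bound q x u" if "0 < u" for u
      using bound[OF that, of n] by simp
  qed
  then show "osc_sum q n x \<le> \<bar>x\<bar> powr q * halfline_integral (osc_bound q 1)"
    unfolding int osc_integral(2)[OF q0 q(2), of x] .
qed

section \<open>Sums of cosines and seminorms from \<open>\<ell>\<^sub>1\<close>\<close>

text \<open>Finite sums of cosines of linear forms with nonnegative weights: the characteristic functions of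
  symmetric finitely supported measures on the space of coefficient vectors \<open>\<theta>\<close>.\<close>

inductive cosine_sum :: "'i set \<Rightarrow> (('i \<Rightarrow> real) \<Rightarrow> real) \<Rightarrow> bool" for J
  where
    zero: "cosine_sum J (\<lambda>_. 0)"
  | add_cos: "cosine_sum J g \<Longrightarrow> 0 \<le> w \<Longrightarrow> cosine_sum J (\<lambda>a. g a + w * cos (\<Sum>j\<in>J. \<theta> j * a j))"

lemma cosine_sum_cos: "0 \<le> w \<Longrightarrow> cosine_sum J (\<lambda>a. w * cos (\<Sum>j\<in>J. \<theta> j * a j))"
  using cosine_sum.add_cos[OF cosine_sum.zero] by simp

lemma cosine_sum_const: "0 \<le> c \<Longrightarrow> cosine_sum J (\<lambda>_. c)"
  using cosine_sum_cos[of c J "\<lambda>_. 0"] by simp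

lemma cosine_sum_add:
  assumes "cosine_sum J g" "cosine_sum J h"
  shows "cosine_sum J (\<lambda>a. g a + h a)"
  using assms(1)
proof induction
  case zero
  then show ?case using assms(2) by simp
next
  case (add_cos g w \<theta>)
  then show ?case
    using cosine_sum.add_cos[OF add_cos.IH, of w \<theta>] by (simp add: add_ac)
qed

text \<open>The product formula for two cosines has nonnegative coefficients.\<close>

lemma cosine_sum_cos_mult:
  assumes "cosine_sum J h" "0 \<le> w"
  shows "cosine_sum J (\<lambda>a. w * cos (\<Sum>j\<in>J. \<theta> j * a j) * h a)"
  using assms(1)
proof induction
  case zero
  then show ?case using cosine_sum.zero by simp
next
  case (add_cos h v \<eta>)
  have "w * cos (\<Sum>j\<in>J. \<theta> j * a j) * (h a + v * cos (\<Sum>j\<in>J. \<eta> j * a j)) =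
      w * cos (\<Sum>j\<in>J. \<theta> j * a j) * h a
      + (w * v / 2) * cos (\<Sum>j\<in>J. (\<theta> j - \<eta> j) * a j)
      + (w * v / 2) * cos (\<Sum>j\<in>J. (\<theta> j + \<eta> j) * a j)" for a
    by (simp add: algebra_simps sum.distrib sum_subtractf cos_add cos_diff)
  moreover have "0 \<le> w * v / 2" using assms(2) add_cos.hyps by simp
  ultimately show ?case
    using cosine_sum.add_cos[OF cosine_sum.add_cos[OF add_cos.IH]] by presburger
qed

lemma cosine_sum_mult:
  assumes "cosine_sum J g" "cosine_sum J h"
  shows "cosine_sum J (\<lambda>a. g a * h a)"
  using assms(1)
proof induction
  case zero
  then show ?case using cosine_sum.zero by simp
next
  case (add_cos g w \<theta>)
  then show ?case
    using cosine_sum_add[OF add_cos.IH cosine_sum_cos_mult[OF assms(2)], of w \<theta>]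
    by (simp add: distrib_right)
qed

lemma cosine_sum_power: "cosine_sum J g \<Longrightarrow> cosine_sum J (\<lambda>a. g a ^ n)"
  by (induction n) (auto intro: cosine_sum_const cosine_sum_mult)

lemma cosine_sum_prod:
  assumes "\<And>k. k \<in> K \<Longrightarrow> cosine_sum J (g k)"
  shows "cosine_sum J (\<lambda>a. \<Prod>k\<in>K. g k a)"
  using assms
  by (induction K rule: infinite_finite_induct) (auto intro: cosine_sum_const cosine_sum_mult)

lemma cosine_sum_sum:
  assumes "\<And>k. k \<in> K \<Longrightarrow> cosine_sum J (g k)"
  shows "cosine_sum J (\<lambda>a. \<Sum>k\<in>K. g k a)"
  using assms
  by (induction K rule: infinite_finite_induct) (auto intro: cosine_sum_const cosine_sum_add)

text \<open>Integration against \<open>t powr - 2\<close> turns each cosine into the absolute value of its linear form.  The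
  weights are absorbed in the coefficient vectors, so the result is the seminorm of \<open>a\<close> under a linear map
  into \<open>\<ell>\<^sub>1\<close>, with one coordinate for each entry of the list.\<close>

lemma cosine_sum_integral:
  assumes "cosine_sum J g"
  shows "\<exists>xs. \<forall>a.
    halfline_integrable (\<lambda>t. (g (\<lambda>_. 0) - g (\<lambda>j. t * a j)) * t powr - 2) \<and>
    halfline_integral (\<lambda>t. (g (\<lambda>_. 0) - g (\<lambda>j. t * a j)) * t powr - 2) =
      (\<Sum>\<theta>\<leftarrow>xs. \<bar>\<Sum>j\<in>J. \<theta> j * a j\<bar>)"
  using assms
proof induction
  case zero
  show ?case by (intro exI[of _ "[]"]) simp
next
  case (add_cos g w \<theta>)
  then obtain xs where xs:
    "\<And>a. halfline_integrable (\<lambda>t. (g (\<lambda>_. 0) - g (\<lambda>j. t * a j)) * t powr - 2)"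
    "\<And>a. halfline_integral (\<lambda>t. (g (\<lambda>_. 0) - g (\<lambda>j. t * a j)) * t powr - 2) =
      (\<Sum>\<theta>\<leftarrow>xs. \<bar>\<Sum>j\<in>J. \<theta> j * a j\<bar>)"
    by blast
  \<comment> \<open>The constant relating the integral of the oscillation to the absolute value.\<close>
  define c where "c = halfline_integral (osc 1 1)"
  have c: "0 < c" unfolding c_def using osc_integral_pos[of 1] by simp
  define x where "x a = (\<Sum>j\<in>J. \<theta> j * a j)" for a :: "'a \<Rightarrow> real"
  define G where "G a t = (g (\<lambda>_. 0) - g (\<lambda>j. t * a j)) * t powr - 2" for a t
  have eq: "(g (\<lambda>_. 0) + w * cos (x (\<lambda>_. 0)) - (g (\<lambda>j. t * a j) + w * cos (x (\<lambda>j. t * a j)))) * t powr - 2 =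
      G a t + w * osc 1 (x a) t" for a t
    unfolding x_def osc_def G_def by (simp add: algebra_simps sum_distrib_left)
  have I: "integrable lborel (\<lambda>t. indicator {0<..} t * G a t)"
    "integrable lborel (\<lambda>t. w * (indicator {0<..} t * osc 1 (x a) t))" for a
    using xs(1) osc_integrable[of 1 "x a"] unfolding G_def by auto
  have int: "halfline_integrable (\<lambda>t. G a t + w * osc 1 (x a) t)" for a
    using Bochner_Integration.integrable_add[OF I(1)[of a] I(2)[of a]] by (simp add: algebra_simps)
  have val: "halfline_integral (\<lambda>t. G a t + w * osc 1 (x a) t) =
      (\<Sum>\<theta>\<leftarrow>(\<lambda>j. w * c * \<theta> j) # xs. \<bar>\<Sum>j\<in>J. \<theta> j * a j\<bar>)" for a
  proof -
    have "halfline_integral (\<lambda>t. G a t + w * osc 1 (x a) t) =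
        integral\<^sup>L lborel (\<lambda>t. indicator {0<..} t * G a t + w * (indicator {0<..} t * osc 1 (x a) t))"
      by (simp add: algebra_simps)
    also have "\<dots> = halfline_integral (G a) + w * halfline_integral (osc 1 (x a))"
      using I[of a] by (subst Bochner_Integration.integral_add) auto
    also have "halfline_integral (osc 1 (x a)) = \<bar>x a\<bar> * c"
      using osc_integral(1)[of 1 "x a"] by (simp add: c_def)
    also have "w * (\<bar>x a\<bar> * c) = \<bar>\<Sum>j\<in>J. w * c * \<theta> j * a j\<bar>"
      using add_cos.hyps c
      by (simp add: x_def abs_mult mult.assoc flip: sum_distrib_left)
    also have "halfline_integral (G a) = (\<Sum>\<theta>\<leftarrow>xs. \<bar>\<Sum>j\<in>J. \<theta> j * a j\<bar>)"
      unfolding G_def by (rule xs(2))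
    finally show ?thesis by simp
  qed
  show ?case
    unfolding x_def[symmetric] eq
    by (rule exI[of _ "(\<lambda>j. w * c * \<theta> j) # xs"], intro allI conjI int val)
qed

text \<open>The analogue of \<^const>\<open>osc\<close> in which \<open>exp (- (|a|\<^sub>q t)\<^sup>q)\<close> takes the place of the cosine; its
  integral is a multiple of \<open>l\<close>, which will be \<open>|a|\<^sub>q\<close> up to a constant.\<close>

definition exp_kernel :: "real \<Rightarrow> real \<Rightarrow> real \<Rightarrow> real"
  where "exp_kernel q l t = (1 - exp (- ((l * t) powr q))) * t powr - 2"

lemma one_minus_exp_le: "1 - exp (- y) \<le> min y (1::real)"
  using exp_ge_add_one_self[of "- y"] by auto

lemma
  assumes q: "1 < q" and l: "0 \<le> l"
  shows exp_kernel_integral: "halfline_integral (exp_kernel q l) = l * halfline_integral (exp_kernel q 1)"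
    and exp_kernel_integral_pos: "0 < halfline_integral (exp_kernel q 1)"
proof -
  have "halfline_integral (exp_kernel q l) = l powr 1 * halfline_integral (exp_kernel q 1)"
  proof (rule halfline_integral_homogeneous[OF l])
    fix u :: real assume "0 < u" "0 < l"
    moreover from this have "l powr (1 + 1) * l powr - 2 = 1"
      by (subst powr_add[symmetric]) simp
    ultimately have "l powr (1 + 1) * (l * u) powr - 2 = u powr - 2"
      by (simp add: powr_mult mult.assoc[symmetric])
    then show "exp_kernel q l u = l powr (1 + 1) * exp_kernel q 1 (l * u)"
      unfolding exp_kernel_def by (simp add: mult.left_commute)
  next
    assume "l = 0"
    then show "halfline_integral (exp_kernel q l) = 0"
      using q by (simp add: exp_kernel_def)
  qed simp
  then show "halfline_integral (exp_kernel q l) = l * halfline_integral (exp_kernel q 1)"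
    using l by simp
  have int: "halfline_integrable (exp_kernel q 1)"
  proof (rule halfline_integrable_bound)
    show "halfline_integrable (\<lambda>u. min (1 * u powr (q - 2)) (1 * u powr - 2))"
      using q by (intro halfline_integrable_min_powr) auto
    show "exp_kernel q 1 \<in> borel_measurable borel"
      unfolding exp_kernel_def by measurable
    fix u :: real assume u: "0 < u"
    have "exp_kernel q 1 u \<le> min (u powr q) 1 * u powr - 2"
      unfolding exp_kernel_def using one_minus_exp_le[of "u powr q"] by (intro mult_right_mono) auto
    also have "\<dots> = min (1 * u powr (q - 2)) (1 * u powr - 2)"
      using u powr_add[of u q "-2"] by (simp add: min_mult_distrib_right)
    finally show "\<bar>exp_kernel q 1 u\<bar> \<le> min (1 * u powr (q - 2)) (1 * u powr - 2)"
      by (simp add: exp_kernel_def)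
  qed
  show "0 < halfline_integral (exp_kernel q 1)"
  proof (rule halfline_integral_pos[OF int, where c = "(1 - exp (- 1)) * 2 powr - 2"])
    fix u :: real assume u: "1 \<le> u" "u \<le> 2"
    have "1 \<le> u powr q" using u q by (simp add: ge_one_powr_ge_zero)
    moreover have "2 powr - 2 \<le> u powr - 2" using u by (intro powr_mono2') auto
    ultimately show "(1 - exp (- 1)) * 2 powr - 2 \<le> exp_kernel q 1 u"
      unfolding exp_kernel_def by (intro mult_mono) auto
  qed (auto simp: exp_kernel_def)
qed

lemma one_minus_prod_le_sum:
  fixes z :: "'i \<Rightarrow> real"
  assumes "\<And>j. j \<in> J \<Longrightarrow> 0 \<le> z j" "\<And>j. j \<in> J \<Longrightarrow> z j \<le> 1"
  shows "1 - (\<Prod>j\<in>J. z j) \<le> (\<Sum>j\<in>J. 1 - z j)"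
  using assms
proof (induction J rule: infinite_finite_induct)
  case (insert x F)
  have P: "0 \<le> prod z F" "prod z F \<le> 1"
    using insert.prems by (auto intro: prod_nonneg prod_le_1)
  have "(1 - z x) * prod z F \<le> (1 - z x) * 1"
    using insert.prems P by (intro mult_left_mono) auto
  then show ?case
    using insert by (simp add: algebra_simps)
qed auto

text \<open>The number of factors has to be free to exceed \<open>n\<close>, because it must dominate the total weight of the
  Riemann sums, which is not bounded by a multiple of \<open>n\<close>.\<close>

lemma power_tendsto_exp:
  fixes y :: "nat \<Rightarrow> real" and M :: "nat \<Rightarrow> nat"
  assumes y: "y \<longlonglongrightarrow> l" "\<And>n. 0 \<le> y n" "\<And>n. y n \<le> real (M n)"
    and M: "\<And>n. n < M n"
  shows "(\<lambda>n. (1 - y n / real (M n)) ^ M n) \<longlonglongrightarrow> exp (- l)"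
proof -
  have D: "\<bar>(1 - y n / real (M n)) ^ M n - exp (- y n)\<bar> \<le> (y n)\<^sup>2 / real (Suc n)" for n
  proof -
    have M0: "0 < real (M n)" using M[of n] by simp
    define x where "x = y n / real (M n)"
    have x: "0 \<le> x" "x \<le> 1" unfolding x_def using y(2,3)[of n] M0 by auto
    have e: "exp (- y n) = exp (- x) ^ M n"
      using M0 by (simp add: x_def flip: exp_of_nat_mult)
    have "norm ((1 - x) ^ M n - exp (- x) ^ M n) \<le> M n * norm ((1 - x) - exp (- x))"
      using x by (intro norm_power_diff) auto
    also have "norm ((1 - x) - exp (- x)) \<le> x\<^sup>2"
    proof -
      have "1 - x \<le> exp (- x)"
        using exp_ge_add_one_self[of "- x"] by simp
      moreover have "exp (- x) \<le> 1 - x + x\<^sup>2"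
      proof -
        have "exp (- x) \<le> 1 / (1 + x)"
          using exp_ge_add_one_self[of x] x by (simp add: exp_minus inverse_eq_divide frac_le)
        also have "\<dots> \<le> 1 - x + x\<^sup>2"
        proof -
          have "1 \<le> (1 - x + x\<^sup>2) * (1 + x)"
            using x by (simp add: algebra_simps power2_eq_square)
          then show ?thesis using x by (simp add: divide_le_eq)
        qed
        finally show ?thesis .
      qed
      ultimately show ?thesis by simp
    qed
    finally have "\<bar>(1 - x) ^ M n - exp (- y n)\<bar> \<le> M n * x\<^sup>2"
      unfolding e by (simp add: mult_left_mono)
    also have "\<dots> = (y n)\<^sup>2 / real (M n)"
      unfolding x_def using M0 by (simp add: power2_eq_square)
    also have "\<dots> \<le> (y n)\<^sup>2 / real (Suc n)"
      using M[of n] by (intro divide_left_mono) auto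
    finally show ?thesis unfolding x_def .
  qed
  have "(\<lambda>n. (y n)\<^sup>2 * inverse (real (Suc n))) \<longlonglongrightarrow> l\<^sup>2 * 0"
    by (intro tendsto_intros y(1) LIMSEQ_inverse_real_of_nat)
  then have "(\<lambda>n. (y n)\<^sup>2 * inverse (real (Suc n))) \<longlonglongrightarrow> 0" by simp
  then have "(\<lambda>n. (1 - y n / real (M n)) ^ M n - exp (- y n)) \<longlonglongrightarrow> 0"
  proof (rule Lim_null_comparison[OF always_eventually, rotated])
    show "\<forall>n. norm ((1 - y n / real (M n)) ^ M n - exp (- y n)) \<le> (y n)\<^sup>2 * inverse (real (Suc n))"
      using D unfolding divide_inverse real_norm_def by blast
  qed
  from tendsto_add[OF this tendsto_exp[OF tendsto_minus[OF y(1)]]]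
  show ?thesis by simp
qed


section \<open>Almost isometric embeddings of \<open>\<ell>\<^sub>q\<close> into \<open>\<ell>\<^sub>1\<close>\<close>

definition fin_norm :: "real \<Rightarrow> 'i set \<Rightarrow> ('i \<Rightarrow> real) \<Rightarrow> real"
  where "fin_norm q J a = (\<Sum>j\<in>J. \<bar>a j\<bar> powr q) powr (1 / q)"

text \<open>The condition on the weights is what makes the constant term nonnegative.\<close>

lemma cosine_sum_osc:
  fixes w s :: "nat \<Rightarrow> real"
  assumes J: "finite J" "j \<in> J" and w: "\<And>k. 0 \<le> w k" "(\<Sum>k<m. w k) \<le> 1"
  shows "cosine_sum J (\<lambda>a. 1 - (\<Sum>k<m. w k * (1 - cos (s k * a j))))"
proof -
  have eq: "1 - (\<Sum>k<m. w k * (1 - cos (s k * a j))) =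
      (1 - (\<Sum>k<m. w k)) + (\<Sum>k<m. w k * cos (\<Sum>i\<in>J. (if i = j then s k else 0) * a i))" for a
  proof -
    have "(\<Sum>i\<in>J. (if i = j then s k else 0) * a i) = s k * a j" for k
      using J by (simp add: if_distrib[of "\<lambda>x. x * _"] cong: if_cong)
    then show ?thesis
      by (simp add: right_diff_distrib sum_subtractf)
  qed
  show ?thesis
    unfolding eq using w by (intro cosine_sum_add cosine_sum_const cosine_sum_sum cosine_sum_cos) auto
qed

text \<open>The functions \<open>G n\<close> in the proof are the characteristic functions of vectors with independent
  coordinates, each of them a sum of \<open>M n\<close> independent copies of a small symmetric variable.  They converge to
  the characteristic function of the \<open>q\<close>-stable law, and the integral transform of
  \<open>cosine_sum_integral\<close> takes \<open>G n\<close> to a seminorm from \<open>\<ell>\<^sub>1\<close> and their limit to a multiple of the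
  \<open>\<ell>\<^sub>q\<close>-norm.  The domination near \<open>t = 0\<close> needs \<open>1 < q\<close>, the one in the Riemann sums needs \<open>q < 2\<close>.\<close>

lemma fin_norm_limit_of_l1_embeddings:
  fixes J :: "'i set"
  assumes J: "finite J" and q: "1 < q" "q < 2"
  shows "\<exists>xs :: nat \<Rightarrow> ('i \<Rightarrow> real) list. \<forall>a.
    (\<lambda>n. \<Sum>\<theta>\<leftarrow>xs n. \<bar>\<Sum>j\<in>J. \<theta> j * a j\<bar>) \<longlonglongrightarrow> fin_norm q J a"
proof -
  define c where "c = halfline_integral (osc q 1)"
  define K where "K = halfline_integral (osc_bound q 1)"
  define w where "w n k = (real (Suc k) / real (Suc n)) powr (- 1 - q) / real (Suc n)" for n k
  define W where "W n = (\<Sum>k<(Suc n)\<^sup>2. w n k)" for n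
  \<comment> \<open>The factor 2 keeps the base of the power in the unit interval; the summand makes M tend to infinity.\<close>
  define M where "M n = 2 * nat \<lceil>W n\<rceil> + Suc n" for n
  define G where "G n a = (\<Prod>j\<in>J. (1 - osc_sum q n (a j) / real (M n)) ^ M n)" for n and a :: "'i \<Rightarrow> real"
  have c: "0 < c" unfolding c_def using osc_integral_pos[of q] q by simp
  have w0: "0 \<le> w n k" for n k unfolding w_def by simp
  have W0: "0 \<le> W n" for n unfolding W_def by (intro sum_nonneg w0)
  have WM: "2 * W n \<le> real (M n)" for n unfolding M_def by linarith
  have M: "n < M n" for n unfolding M_def by linarith
  have osc_sum_eq: "osc_sum q n x =
      (\<Sum>k<(Suc n)\<^sup>2. w n k * (1 - cos (real (Suc k) / real (Suc n) * x)))" for n x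
    unfolding osc_sum_def osc_def w_def by (intro sum.cong) simp_all
  have osc_sum_ge: "0 \<le> osc_sum q n x" for n x
    unfolding osc_sum_def by (intro sum_nonneg divide_nonneg_nonneg osc_nonneg) auto
  have osc_sum_M: "osc_sum q n x \<le> real (M n)" for n x
  proof -
    have "osc_sum q n x \<le> (\<Sum>k<(Suc n)\<^sup>2. w n k * 2)"
      unfolding osc_sum_eq
    proof (intro sum_mono mult_left_mono w0)
      show "1 - cos (real (Suc k) / real (Suc n) * x) \<le> 2" for k
        using cos_ge_minus_one[of "real (Suc k) / real (Suc n) * x"] by linarith
    qed
    also have "\<dots> = 2 * W n" unfolding W_def by (simp add: sum_distrib_left mult.commute)
    finally show ?thesis using WM[of n] by linarith
  qed
  have unit: "0 \<le> 1 - osc_sum q n x / real (M n)" "1 - osc_sum q n x / real (M n) \<le> 1" for n x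
    using osc_sum_ge[of n x] osc_sum_M[of n x] M[of n] by (auto simp: divide_le_eq)
  have G_mix: "cosine_sum J (G n)" for n
  proof -
    have "cosine_sum J (\<lambda>a. 1 - osc_sum q n (a j) / real (M n))" if j: "j \<in> J" for j
    proof -
      have "(\<Sum>k<(Suc n)\<^sup>2. w n k / real (M n)) = W n / real (M n)"
        unfolding W_def by (simp add: sum_divide_distrib)
      also have "\<dots> \<le> 1" using WM[of n] W0[of n] by (simp add: divide_le_eq)
      finally have "cosine_sum J (\<lambda>a. 1 - (\<Sum>k<(Suc n)\<^sup>2. w n k / real (M n) *
          (1 - cos (real (Suc k) / real (Suc n) * a j))))"
        by (intro cosine_sum_osc[OF J j]) (use w0 in simp)
      then show ?thesis
        unfolding osc_sum_eq by (simp add: sum_divide_distrib)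
    qed
    then show ?thesis
      unfolding G_def by (intro cosine_sum_prod cosine_sum_power)
  qed
  have G0: "G n (\<lambda>_. 0) = 1" for n
    unfolding G_def osc_sum_eq by simp
  have G_range: "0 \<le> G n a" "G n a \<le> 1" for n a
    unfolding G_def using unit by (auto intro!: prod_nonneg prod_le_1 power_le_one)
  have G_lower: "1 - G n a \<le> K * (\<Sum>j\<in>J. \<bar>a j\<bar> powr q)" for n a
  proof -
    have "1 - G n a \<le> (\<Sum>j\<in>J. 1 - (1 - osc_sum q n (a j) / real (M n)) ^ M n)"
      unfolding G_def using unit by (intro one_minus_prod_le_sum) (auto intro: power_le_one)
    also have "\<dots> \<le> (\<Sum>j\<in>J. K * \<bar>a j\<bar> powr q)"
    proof (rule sum_mono)
      fix j
      have "1 + real (M n) * (- (osc_sum q n (a j) / real (M n))) \<le> (1 + - (osc_sum q n (a j) / real (M n))) ^ M n"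
        using unit(1)[of n "a j"] by (intro Bernoulli_inequality) linarith
      then have "1 - (1 - osc_sum q n (a j) / real (M n)) ^ M n \<le> osc_sum q n (a j)"
        using M[of n] by simp
      also have "\<dots> \<le> K * \<bar>a j\<bar> powr q"
        using osc_sum_le[of q n "a j"] q by (simp add: K_def mult.commute)
      finally show "1 - (1 - osc_sum q n (a j) / real (M n)) ^ M n \<le> K * \<bar>a j\<bar> powr q" .
    qed
    finally show ?thesis by (simp add: sum_distrib_left)
  qed
  have G_lim: "(\<lambda>n. G n a) \<longlonglongrightarrow> exp (- (c * (\<Sum>j\<in>J. \<bar>a j\<bar> powr q)))" for a
  proof -
    have "(\<lambda>n. G n a) \<longlonglongrightarrow> (\<Prod>j\<in>J. exp (- (\<bar>a j\<bar> powr q * c)))"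
      unfolding G_def
    proof (intro tendsto_prod power_tendsto_exp osc_sum_ge osc_sum_M M)
      fix j show "(\<lambda>n. osc_sum q n (a j)) \<longlonglongrightarrow> \<bar>a j\<bar> powr q * c"
        unfolding c_def using q by (intro osc_sum_tendsto) auto
    qed
    also have "(\<Prod>j\<in>J. exp (- (\<bar>a j\<bar> powr q * c))) = exp (- (c * (\<Sum>j\<in>J. \<bar>a j\<bar> powr q)))"
      using J by (simp add: sum_distrib_left mult.commute flip: exp_sum sum_negf)
    finally show ?thesis .
  qed
  define C where "C = c powr (1 / q) * halfline_integral (exp_kernel q 1)"
  have C: "0 < C" unfolding C_def using c exp_kernel_integral_pos[of q 0] q by simp
  obtain ys where ys: "\<And>n a. halfline_integral (\<lambda>t. (1 - G n (\<lambda>j. t * a j)) * t powr - 2) =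
      (\<Sum>\<theta>\<leftarrow>ys n. \<bar>\<Sum>j\<in>J. \<theta> j * a j\<bar>)"
    using cosine_sum_integral[OF G_mix] unfolding G0 by metis
  have lim: "(\<lambda>n. \<Sum>\<theta>\<leftarrow>ys n. \<bar>\<Sum>j\<in>J. \<theta> j * a j\<bar>) \<longlonglongrightarrow> C * fin_norm q J a" for a
  proof -
    define S where "S = (\<Sum>j\<in>J. \<bar>a j\<bar> powr q)"
    have S: "0 \<le> S" unfolding S_def by (intro sum_nonneg) simp
    define l where "l = (c * S) powr (1 / q)"
    have scale: "(\<Sum>j\<in>J. \<bar>t * a j\<bar> powr q) = t powr q * S" if "0 < t" for t
      using that unfolding S_def by (simp add: abs_mult powr_mult sum_distrib_left)
    have l: "(l * t) powr q = c * (t powr q * S)" if "0 < t" for t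
    proof -
      have "l powr q = c * S"
        unfolding l_def using q S c by (simp add: powr_powr)
      then show ?thesis
        using that by (simp add: powr_mult l_def)
    qed
    have K: "0 \<le> K"
      unfolding K_def osc_bound_def by (intro integral_nonneg_AE AE_I2) auto
    have "(\<lambda>n. halfline_integral (\<lambda>t. (1 - G n (\<lambda>j. t * a j)) * t powr - 2)) \<longlonglongrightarrow>
        halfline_integral (exp_kernel q l)"
    proof (rule halfline_dominated_convergence)
      show "exp_kernel q l \<in> borel_measurable borel"
        unfolding exp_kernel_def by measurable
      show "(\<lambda>t. (1 - G n (\<lambda>j. t * a j)) * t powr - 2) \<in> borel_measurable borel" for n
        unfolding G_def osc_sum_eq by measurable
      show "halfline_integrable (\<lambda>t. min ((K * S) * t powr (q - 2)) (1 * t powr - 2))"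
        using q K S by (intro halfline_integrable_min_powr) auto
      fix t :: real assume t: "0 < t"
      show "(\<lambda>n. (1 - G n (\<lambda>j. t * a j)) * t powr - 2) \<longlonglongrightarrow> exp_kernel q l t"
        unfolding exp_kernel_def l[OF t] scale[OF t, symmetric]
        by (intro tendsto_intros G_lim)
      show "\<bar>(1 - G n (\<lambda>j. t * a j)) * t powr - 2\<bar> \<le> min ((K * S) * t powr (q - 2)) (1 * t powr - 2)" for n
      proof -
        have "(1 - G n (\<lambda>j. t * a j)) * t powr - 2 \<le> min (K * (t powr q * S)) 1 * t powr - 2"
          using G_lower[of n "\<lambda>j. t * a j"] G_range[of n "\<lambda>j. t * a j"] scale[OF t]
          by (intro mult_right_mono) auto
        also have "\<dots> = min ((K * S) * t powr (q - 2)) (1 * t powr - 2)"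
        proof -
          have "t powr (q - 2) = t powr q * t powr - 2" by (simp flip: powr_add)
          then show ?thesis by (subst min_mult_distrib_right) (simp add: mult_ac)
        qed
        finally show ?thesis using G_range[of n "\<lambda>j. t * a j"] by simp
      qed
    qed
    moreover have "halfline_integral (exp_kernel q l) = C * fin_norm q J a"
      using q c S exp_kernel_integral[of q l]
      by (simp add: C_def fin_norm_def l_def powr_mult S_def)
    ultimately show ?thesis unfolding ys by simp
  qed
  have "(\<lambda>n. \<Sum>\<theta>\<leftarrow>map (\<lambda>\<theta> j. \<theta> j / C) (ys n). \<bar>\<Sum>j\<in>J. \<theta> j * a j\<bar>) \<longlonglongrightarrow> fin_norm q J a" for a
  proof -
    have "\<bar>\<Sum>j\<in>J. \<theta> j / C * a j\<bar> = \<bar>\<Sum>j\<in>J. \<theta> j * a j\<bar> / C" for \<theta>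
    proof -
      have "(\<Sum>j\<in>J. \<theta> j / C * a j) = (\<Sum>j\<in>J. \<theta> j * a j) / C"
        by (simp add: sum_divide_distrib)
      then show ?thesis using C by simp
    qed
    then have "(\<Sum>\<theta>\<leftarrow>map (\<lambda>\<theta> j. \<theta> j / C) zs. \<bar>\<Sum>j\<in>J. \<theta> j * a j\<bar>) =
        (\<Sum>\<theta>\<leftarrow>zs. \<bar>\<Sum>j\<in>J. \<theta> j * a j\<bar>) / C" for zs
      by (induction zs) (simp_all add: add_divide_distrib)
    then show ?thesis
      using tendsto_divide[OF lim[of a] tendsto_const[of C]] C by simp
  qed
  then show ?thesis by (intro exI[of _ "\<lambda>n. map (\<lambda>\<theta> j. \<theta> j / C) (ys n)"]) blast
qed

lemma fin_norm_scale:
  assumes "0 < s" "1 < q"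
  shows "fin_norm q J (\<lambda>j. s * a j) = s * fin_norm q J a"
proof -
  have "(\<Sum>j\<in>J. \<bar>s * a j\<bar> powr q) = s powr q * (\<Sum>j\<in>J. \<bar>a j\<bar> powr q)"
    using assms by (simp add: abs_mult powr_mult sum_distrib_left)
  then show ?thesis
    using assms by (simp add: fin_norm_def powr_mult powr_powr sum_nonneg)
qed

lemma fin_norm_mono:
  assumes "\<And>j. j \<in> J \<Longrightarrow> \<bar>b j\<bar> \<le> \<bar>a j\<bar>" "1 < q"
  shows "fin_norm q J b \<le> fin_norm q J a"
  unfolding fin_norm_def using assms
  by (intro powr_mono2 sum_mono) (auto intro: sum_nonneg)

lemma coordinate_le_fin_norm:
  assumes "finite J" "j \<in> J" "1 < q"
  shows "\<bar>a j\<bar> \<le> fin_norm q J a"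
proof -
  have "\<bar>a j\<bar> powr q \<le> (\<Sum>j\<in>J. \<bar>a j\<bar> powr q)"
    using assms by (intro member_le_sum) auto
  then have "(\<bar>a j\<bar> powr q) powr (1 / q) \<le> fin_norm q J a"
    unfolding fin_norm_def using assms by (intro powr_mono2) auto
  then show ?thesis using assms by (simp add: powr_powr)
qed

text \<open>A seminorm is Lipschitz with respect to the coordinates, with its values at the unit vectors as
  constants.\<close>

lemma l1_seminorm_le:
  fixes xs :: "('i \<Rightarrow> real) list"
  assumes "finite J"
  shows "(\<Sum>\<theta>\<leftarrow>xs. \<bar>\<Sum>j\<in>J. \<theta> j * a j\<bar>) \<le> (\<Sum>\<theta>\<leftarrow>xs. \<bar>\<Sum>j\<in>J. \<theta> j * b j\<bar>) +
    (\<Sum>i\<in>J. \<bar>a i - b i\<bar> * (\<Sum>\<theta>\<leftarrow>xs. \<bar>\<Sum>j\<in>J. \<theta> j * (if j = i then 1 else 0)\<bar>))"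
proof (induction xs)
  case Nil
  show ?case by simp
next
  case (Cons \<theta> xs)
  have 1: "(\<Sum>j\<in>J. \<theta> j * (if j = i then 1 else 0)) = \<theta> i" if "i \<in> J" for i
    using that assms by (simp add: if_distrib[of "\<lambda>x. _ * x"] cong: if_cong)
  have "(\<Sum>j\<in>J. \<theta> j * a j) = (\<Sum>j\<in>J. \<theta> j * b j) + (\<Sum>j\<in>J. \<theta> j * (a j - b j))"
    by (simp add: algebra_simps flip: sum.distrib)
  then have "\<bar>\<Sum>j\<in>J. \<theta> j * a j\<bar> \<le> \<bar>\<Sum>j\<in>J. \<theta> j * b j\<bar> + \<bar>\<Sum>j\<in>J. \<theta> j * (a j - b j)\<bar>"
    by simp
  also have "\<bar>\<Sum>j\<in>J. \<theta> j * (a j - b j)\<bar> \<le> (\<Sum>j\<in>J. \<bar>a j - b j\<bar> * \<bar>\<theta> j\<bar>)"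
    by (rule order_trans[OF sum_abs]) (simp add: abs_mult mult.commute)
  also have "\<dots> = (\<Sum>i\<in>J. \<bar>a i - b i\<bar> * \<bar>\<Sum>j\<in>J. \<theta> j * (if j = i then 1 else 0)\<bar>)"
    by (intro sum.cong refl) (simp only: 1)
  finally show ?case
    using Cons.IH by (simp add: distrib_left sum.distrib)
qed

text \<open>Rounding towards zero, so that no coordinate grows and the \<open>\<ell>\<^sub>q\<close>-norm does not increase.\<close>

lemma grid_rounding:
  fixes x :: real and m :: nat
  assumes "0 < m" "\<bar>x\<bar> \<le> 1"
  obtains k :: int where "k \<in> {- int m..int m}" "\<bar>of_int k / real m\<bar> \<le> \<bar>x\<bar>" "\<bar>x - of_int k / real m\<bar> \<le> 1 / real m"
proof -
  define y where "y = real m * \<bar>x\<bar>"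
  define l where "l = \<lfloor>y\<rfloor>"
  have y: "0 \<le> y" "y \<le> real m" unfolding y_def using assms by (auto simp: mult_le_cancel_left1)
  have l: "0 \<le> l" "of_int l \<le> y" "y - of_int l \<le> 1" "l \<le> int m"
    unfolding l_def using y by (auto simp: floor_le_iff) linarith+
  have xl: "of_int l / real m \<le> \<bar>x\<bar>" "\<bar>x\<bar> - of_int l / real m \<le> 1 / real m"
  proof -
    have "\<bar>x\<bar> \<le> (of_int l + 1) / real m"
      using l(3) assms by (simp add: pos_le_divide_eq y_def mult.commute)
    then show "\<bar>x\<bar> - of_int l / real m \<le> 1 / real m"
      by (simp add: add_divide_distrib)
    show "of_int l / real m \<le> \<bar>x\<bar>"
      using l(2) assms by (simp add: pos_divide_le_eq y_def mult.commute)
  qed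
  show ?thesis
  proof (cases "0 \<le> x")
    case True
    then show ?thesis using l xl by (intro that[of l]) auto
  next
    case False
    then show ?thesis using l xl by (intro that[of "- l"]) auto
  qed
qed

text \<open>Pointwise convergence of the seminorms is only used on a finite set: the set \<open>A\<close>, a grid in the unit
  ball, and the unit vectors.  The Lipschitz estimate extends the upper bound from the grid to the whole ball,
  and a final rescaling turns \<open>1 + 3 * \<eta>\<close> into \<open>1\<close>.\<close>

lemma lq_almost_isometric_in_l1:
  fixes J :: "'i set" and A :: "('i \<Rightarrow> real) set"
  assumes J: "finite J" and q: "1 < q" "q < 2" and A: "finite A" and \<epsilon>: "0 < \<epsilon>"
  obtains xs :: "('i \<Rightarrow> real) list"
  where "\<And>a. (\<Sum>\<theta>\<leftarrow>xs. \<bar>\<Sum>j\<in>J. \<theta> j * a j\<bar>) \<le> fin_norm q J a"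
    and "\<And>a. a \<in> A \<Longrightarrow> fin_norm q J a \<le> 1 \<Longrightarrow> fin_norm q J a - \<epsilon> \<le> (\<Sum>\<theta>\<leftarrow>xs. \<bar>\<Sum>j\<in>J. \<theta> j * a j\<bar>)"
proof -
  define \<eta> where "\<eta> = min 1 (\<epsilon> / 6)"
  have \<eta>: "0 < \<eta>" "\<eta> \<le> 1" "6 * \<eta> \<le> \<epsilon>" using \<epsilon> by (auto simp: \<eta>_def)
  define m where "m = Suc (nat \<lceil>real (card J) / \<eta>\<rceil>)"
  have m: "0 < m" "real (card J) / real m \<le> \<eta>"
  proof -
    have "real (card J) / \<eta> \<le> real m" "0 < real m" unfolding m_def by linarith+
    then show "real (card J) / real m \<le> \<eta>"
      using \<eta> by (simp add: pos_divide_le_eq mult.commute)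
  qed (simp add: m_def)
  define \<Gamma> where "\<Gamma> = PiE J (\<lambda>_. (\<lambda>k. of_int k / real m) ` {- int m..int m})"
  define e where "e i = (\<lambda>j. if j = i then 1 else (0::real))" for i :: 'i
  have fin: "finite (A \<union> \<Gamma> \<union> e ` J)"
    unfolding \<Gamma>_def using J A by (auto intro!: finite_PiE)
  obtain zs where zs: "\<And>a. (\<lambda>n. \<Sum>\<theta>\<leftarrow>zs n. \<bar>\<Sum>j\<in>J. \<theta> j * a j\<bar>) \<longlonglongrightarrow> fin_norm q J a"
    using fin_norm_limit_of_l1_embeddings[OF J q] by blast
  have "\<forall>\<^sub>F n in sequentially. \<forall>a\<in>A \<union> \<Gamma> \<union> e ` J.
      dist (\<Sum>\<theta>\<leftarrow>zs n. \<bar>\<Sum>j\<in>J. \<theta> j * a j\<bar>) (fin_norm q J a) < \<eta>"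
    using zs \<eta> by (intro eventually_ball_finite[OF fin]) (auto dest: tendstoD)
  then obtain n where n: "\<And>a. a \<in> A \<union> \<Gamma> \<union> e ` J \<Longrightarrow>
      dist (\<Sum>\<theta>\<leftarrow>zs n. \<bar>\<Sum>j\<in>J. \<theta> j * a j\<bar>) (fin_norm q J a) < \<eta>"
    unfolding eventually_sequentially by blast
  define N where "N a = (\<Sum>\<theta>\<leftarrow>zs n. \<bar>\<Sum>j\<in>J. \<theta> j * a j\<bar>)" for a
  have near: "\<bar>N a - fin_norm q J a\<bar> \<le> \<eta>" if "a \<in> A \<union> \<Gamma> \<union> e ` J" for a
    using n[OF that] unfolding N_def dist_real_def by simp
  have Ne: "N (e i) \<le> 2" if "i \<in> J" for i
  proof -
    have "\<bar>e i j\<bar> powr q = (if j = i then 1 else 0)" for j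
      by (simp add: e_def)
    then have "(\<Sum>j\<in>J. \<bar>e i j\<bar> powr q) = (\<Sum>j\<in>J. if j = i then 1 else 0)"
      by (intro sum.cong refl)
    also have "\<dots> = 1"
      using that J by simp
    finally have "(\<Sum>j\<in>J. \<bar>e i j\<bar> powr q) = 1" .
    then have "fin_norm q J (e i) = 1" unfolding fin_norm_def by simp
    then show ?thesis using near[of "e i"] that \<eta> by auto
  qed
  have N_scale: "N (\<lambda>j. s * a j) = s * N a" if "0 \<le> s" for s a
  proof -
    have "\<bar>\<Sum>j\<in>J. \<theta> j * (s * a j)\<bar> = s * \<bar>\<Sum>j\<in>J. \<theta> j * a j\<bar>" for \<theta>
    proof -
      have "(\<Sum>j\<in>J. \<theta> j * (s * a j)) = s * (\<Sum>j\<in>J. \<theta> j * a j)"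
        by (simp add: sum_distrib_left mult.left_commute)
      then show ?thesis using that by (simp add: abs_mult)
    qed
    then have "(\<Sum>\<theta>\<leftarrow>ys. \<bar>\<Sum>j\<in>J. \<theta> j * (s * a j)\<bar>) = s * (\<Sum>\<theta>\<leftarrow>ys. \<bar>\<Sum>j\<in>J. \<theta> j * a j\<bar>)" for ys
      by (simp only: sum_list_const_mult)
    from this[of "zs n"] show ?thesis unfolding N_def .
  qed
  \<comment> \<open>One error term at the grid point, two from the distance to it, as the seminorm of a unit vector is at most 2.\<close>
  have ball: "N a \<le> 1 + 3 * \<eta>" if a: "fin_norm q J a \<le> 1" for a
  proof -
    have "\<exists>k. k \<in> {- int m..int m} \<and> \<bar>of_int k / real m\<bar> \<le> \<bar>a j\<bar> \<and> \<bar>a j - of_int k / real m\<bar> \<le> 1 / real m"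
      if "j \<in> J" for j
    proof -
      have "\<bar>a j\<bar> \<le> 1" using coordinate_le_fin_norm[OF J that q(1), of a] a by linarith
      from grid_rounding[OF m(1) this] show ?thesis by blast
    qed
    then obtain k where k: "\<And>j. j \<in> J \<Longrightarrow> k j \<in> {- int m..int m}"
      "\<And>j. j \<in> J \<Longrightarrow> \<bar>of_int (k j) / real m\<bar> \<le> \<bar>a j\<bar>"
      "\<And>j. j \<in> J \<Longrightarrow> \<bar>a j - of_int (k j) / real m\<bar> \<le> 1 / real m"
      by metis
    define b where "b = restrict (\<lambda>j. of_int (k j) / real m) J"
    have b: "b \<in> \<Gamma>"
      unfolding \<Gamma>_def b_def using k(1) by auto
    have "fin_norm q J b \<le> 1"
      using fin_norm_mono[of J b a q] k(2) a q by (simp add: b_def)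
    then have "N b \<le> 1 + \<eta>" using near[of b] b by simp
    moreover have "N a \<le> N b + (\<Sum>i\<in>J. \<bar>a i - b i\<bar> * N (e i))"
      using l1_seminorm_le[OF J, where xs = "zs n" and a = a and b = b] unfolding N_def e_def .
    moreover have "(\<Sum>i\<in>J. \<bar>a i - b i\<bar> * N (e i)) \<le> (\<Sum>i\<in>J. 1 / real m * 2)"
      using k(3) Ne by (intro sum_mono mult_mono) (auto simp: b_def N_def intro!: sum_list_nonneg)
    moreover have "(\<Sum>i\<in>J. 1 / real m * 2) \<le> 2 * \<eta>"
    proof -
      have "(\<Sum>i\<in>J. 1 / real m * 2) = 2 * (real (card J) / real m)" by simp
      then show ?thesis using m(2) by linarith
    qed
    ultimately show ?thesis by linarith
  qed
  have upper: "N a \<le> (1 + 3 * \<eta>) * fin_norm q J a" for a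
  proof (cases "fin_norm q J a = 0")
    case True
    then have "a j = 0" if "j \<in> J" for j
      using coordinate_le_fin_norm[OF J that q(1), of a] by simp
    then have "(\<Sum>j\<in>J. \<theta> j * a j) = 0" for \<theta>
      by simp
    then have "N a = 0" unfolding N_def by simp
    then show ?thesis using True by simp
  next
    case False
    then have l: "0 < fin_norm q J a" unfolding fin_norm_def by simp
    have "fin_norm q J (\<lambda>j. inverse (fin_norm q J a) * a j) \<le> 1"
      using fin_norm_scale[of "inverse (fin_norm q J a)" q J a] l q by simp
    then have "N (\<lambda>j. inverse (fin_norm q J a) * a j) \<le> 1 + 3 * \<eta>"
      by (rule ball)
    then have "inverse (fin_norm q J a) * N a \<le> 1 + 3 * \<eta>"
      using N_scale[of "inverse (fin_norm q J a)" a] l by simp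
    then have "N a / fin_norm q J a \<le> 1 + 3 * \<eta>"
      by (simp add: divide_inverse mult.commute)
    then show ?thesis
      using l by (simp only: pos_divide_le_eq)
  qed
  define s where "s = 1 + 3 * \<eta>"
  have s: "0 < s" using \<eta> by (simp add: s_def)
  have map_eq: "(\<Sum>\<theta>\<leftarrow>map (\<lambda>\<theta> j. \<theta> j / s) (zs n). \<bar>\<Sum>j\<in>J. \<theta> j * a j\<bar>) = N a / s" for a
  proof -
    have "(\<lambda>\<theta>. \<bar>\<Sum>j\<in>J. \<theta> j / s * a j\<bar>) = (\<lambda>\<theta>. \<bar>\<Sum>j\<in>J. \<theta> j * (inverse s * a j)\<bar>)"
      by (simp add: divide_inverse mult.assoc)
    then have "(\<Sum>\<theta>\<leftarrow>map (\<lambda>\<theta> j. \<theta> j / s) (zs n). \<bar>\<Sum>j\<in>J. \<theta> j * a j\<bar>) = N (\<lambda>j. inverse s * a j)"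
      unfolding N_def by (simp add: o_def)
    then show ?thesis
      using N_scale[of "inverse s" a] s by (simp add: divide_inverse mult.commute)
  qed
  show ?thesis
  proof (rule that[of "map (\<lambda>\<theta> j. \<theta> j / s) (zs n)"])
    show "(\<Sum>\<theta>\<leftarrow>map (\<lambda>\<theta> j. \<theta> j / s) (zs n). \<bar>\<Sum>j\<in>J. \<theta> j * a j\<bar>) \<le> fin_norm q J a" for a
      unfolding map_eq using upper[of a] s by (simp add: s_def field_simps)
  next
    fix a assume a: "a \<in> A" "fin_norm q J a \<le> 1"
    define l where "l = fin_norm q J a"
    have "l - \<eta> \<le> N a" using near[of a] a by (auto simp: l_def)
    moreover have "(l - \<epsilon>) * s \<le> l - \<eta>"
    proof -
      have "l * s \<le> l + 3 * \<eta>"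
        using a(2) \<eta> by (simp add: s_def l_def algebra_simps)
      moreover have "\<epsilon> \<le> \<epsilon> * s" using \<epsilon> \<eta> by (simp add: s_def)
      ultimately show ?thesis using \<eta> unfolding left_diff_distrib by linarith
    qed
    ultimately have "l - \<epsilon> \<le> N a / s" using s by (simp add: pos_le_divide_eq)
    then show "fin_norm q J a - \<epsilon> \<le> (\<Sum>\<theta>\<leftarrow>map (\<lambda>\<theta> j. \<theta> j / s) (zs n). \<bar>\<Sum>j\<in>J. \<theta> j * a j\<bar>)"
      unfolding map_eq l_def .
  qed
qed

lemma Hoelder_sum:
  fixes x a :: "'i \<Rightarrow> real"
  assumes "1 < p" "1 < q" "1 / p + 1 / q = 1" and J: "finite J"
  shows "(\<Sum>j\<in>J. \<bar>x j\<bar> * \<bar>a j\<bar>) \<le> fin_norm p J x * fin_norm q J a"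
proof (cases "fin_norm p J x = 0 \<or> fin_norm q J a = 0")
  case True
  have zero: "y j = 0" if "fin_norm r J y = 0" "j \<in> J" for r and y :: "'i \<Rightarrow> real" and j
    using that J by (simp add: fin_norm_def sum_nonneg_eq_0_iff)
  have "(\<Sum>j\<in>J. \<bar>x j\<bar> * \<bar>a j\<bar>) = 0"
    using True zero by (intro sum.neutral) fastforce
  then show ?thesis using True by (simp add: fin_norm_def)
next
  case False
  define X A where "X = fin_norm p J x" and "A = fin_norm q J a"
  have XA: "0 < X" "0 < A" using False by (auto simp: X_def A_def fin_norm_def)
  have pow: "(\<Sum>j\<in>J. (\<bar>y j\<bar> / fin_norm r J y) powr r) = 1"
    if "1 < r" "0 < fin_norm r J y" for r and y :: "'i \<Rightarrow> real"
  proof -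
    have "fin_norm r J y powr r = (\<Sum>j\<in>J. \<bar>y j\<bar> powr r)"
      using that by (simp add: fin_norm_def powr_powr sum_nonneg)
    moreover have "(\<Sum>j\<in>J. (\<bar>y j\<bar> / fin_norm r J y) powr r) = (\<Sum>j\<in>J. \<bar>y j\<bar> powr r) / fin_norm r J y powr r"
      using that by (simp add: powr_divide sum_divide_distrib)
    moreover have "0 < fin_norm r J y powr r" using that by simp
    ultimately show ?thesis by simp
  qed
  have "(\<Sum>j\<in>J. (\<bar>x j\<bar> / X) * (\<bar>a j\<bar> / A)) \<le>
      (\<Sum>j\<in>J. (\<bar>x j\<bar> / X) powr p / p + (\<bar>a j\<bar> / A) powr q / q)"
    using XA assms by (intro sum_mono Youngs_inequality) auto
  also have "\<dots> = 1"
    using pow[OF assms(1) XA(1)[unfolded X_def]] pow[OF assms(2) XA(2)[unfolded A_def]] assms(3)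
    unfolding X_def A_def by (simp add: sum.distrib flip: sum_divide_distrib)
  finally have "(\<Sum>j\<in>J. \<bar>x j\<bar> * \<bar>a j\<bar>) / (X * A) \<le> 1"
    by (simp add: sum_divide_distrib)
  then show ?thesis
    using XA unfolding X_def A_def by (simp add: divide_le_eq)
qed


section \<open>The space \<open>\<ell>\<^sub>p(I)\<close> and its dual\<close>

locale lp_isometry =
  fixes I :: "'i set" and p :: real and U :: "'l::real_normed_vector \<Rightarrow> 'i \<Rightarrow> real"
  assumes p: "1 < p" and iso: "is_lp_space I p U"
begin

lemma U_add: "U (x + y) = (\<lambda>i. U x i + U y i)"
  and U_scale: "U (c *\<^sub>R x) = (\<lambda>i. c * U x i)"
  and U_inj: "U x = U y \<Longrightarrow> x = y"
  and U_mem: "U x \<in> lp_space I p"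
  and U_surj: "f \<in> lp_space I p \<Longrightarrow> U (inv U f) = f"
  and norm_U: "norm x = lp_norm I p (U x)"
  using iso unfolding is_lp_space_def bij_betw_def inj_def
  by (auto intro!: f_inv_into_f)

lemma U_diff: "U (x - y) = (\<lambda>i. U x i - U y i)"
  using U_add[of x "(-1) *\<^sub>R y"] U_scale[of "-1" y] by simp

lemma U_outside: "i \<notin> I \<Longrightarrow> U x i = 0"
  and U_summable: "(\<lambda>i. \<bar>U x i\<bar> powr p) summable_on I"
  using U_mem[of x] unfolding lp_space_def by auto

lemma norm_powr: "norm x powr p = (\<Sum>\<^sub>\<infinity>i\<in>I. \<bar>U x i\<bar> powr p)"
proof -
  have "0 \<le> (\<Sum>\<^sub>\<infinity>i\<in>I. \<bar>U x i\<bar> powr p)" by (intro infsum_nonneg) simp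
  then show ?thesis
    unfolding norm_U lp_norm_def using p by (simp add: powr_powr)
qed

lemma norm_le_iff_powr: "0 \<le> r \<Longrightarrow> norm x \<le> r \<longleftrightarrow> norm x powr p \<le> r powr p"
  using p powr_mono2[of p "norm x" r] powr_less_mono2[of p r "norm x"] by (auto simp: not_less[symmetric])

lemma coordinate_le_norm: "\<bar>U x i\<bar> \<le> norm x"
proof (cases "i \<in> I")
  case True
  have "(\<Sum>\<^sub>\<infinity>j\<in>{i}. \<bar>U x j\<bar> powr p) \<le> (\<Sum>\<^sub>\<infinity>j\<in>I. \<bar>U x j\<bar> powr p)"
    using True U_summable[of x] by (intro infsum_mono_neutral) auto
  then have "\<bar>U x i\<bar> powr p \<le> norm x powr p"
    unfolding norm_powr by simp
  then show ?thesis
    using p powr_less_mono2[of p "norm x" "\<bar>U x i\<bar>"] by (auto simp: not_less[symmetric])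
qed (simp add: U_outside)

definition coord :: "'i \<Rightarrow> 'l dual"
  where "coord i = Blinfun (\<lambda>x. U x i)"

lemma coord_apply [simp]: "blinfun_apply (coord i) x = U x i"
proof -
  have "bounded_linear (\<lambda>x. U x i)"
    by (rule bounded_linear_intro[where K = 1]) (auto simp: U_add U_scale coordinate_le_norm)
  then show ?thesis unfolding coord_def by (simp add: bounded_linear_Blinfun_apply)
qed

lemma finite_support_mem:
  assumes "finite J" "J \<subseteq> I"
  shows "(\<lambda>i. if i \<in> J then a i else 0) \<in> lp_space I p"
proof -
  have "(\<lambda>i. \<bar>if i \<in> J then a i else 0\<bar> powr p) summable_on I"
    using assms by (intro summable_on_cong_neutral[THEN iffD1, OF _ _ _ summable_on_finite[OF assms(1)]]) auto
  then show ?thesis using assms unfolding lp_space_def by auto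
qed

definition fin_vec :: "'i set \<Rightarrow> ('i \<Rightarrow> real) \<Rightarrow> 'l"
  where "fin_vec J a = inv U (\<lambda>i. if i \<in> J then a i else 0)"

definition unit_vec :: "'i \<Rightarrow> 'l"
  where "unit_vec i = fin_vec {i} (\<lambda>_. 1)"

lemma U_vec: "finite J \<Longrightarrow> J \<subseteq> I \<Longrightarrow> U (fin_vec J a) = (\<lambda>i. if i \<in> J then a i else 0)"
  unfolding fin_vec_def by (intro U_surj finite_support_mem)

lemma U_unit: "i \<in> I \<Longrightarrow> U (unit_vec i) = (\<lambda>j. if j = i then 1 else 0)"
  unfolding unit_vec_def by (subst U_vec) auto

lemma norm_vec_powr:
  assumes "finite J" "J \<subseteq> I"
  shows "norm (fin_vec J a) powr p = (\<Sum>j\<in>J. \<bar>a j\<bar> powr p)"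
proof -
  have "norm (fin_vec J a) powr p = (\<Sum>\<^sub>\<infinity>j\<in>J. \<bar>a j\<bar> powr p)"
    unfolding norm_powr U_vec[OF assms]
    by (intro infsum_cong_neutral) (use assms in auto)
  then show ?thesis using assms by simp
qed

lemma norm_unit: "i \<in> I \<Longrightarrow> norm (unit_vec i) = 1"
proof -
  assume "i \<in> I"
  then have "(norm (unit_vec i) powr p) powr (1 / p) = 1"
    using norm_vec_powr[of "{i}" "\<lambda>_. 1"] unfolding unit_vec_def by simp
  then show ?thesis using p by (simp add: powr_powr)
qed

lemma vec_eq_sum:
  assumes "finite J" "J \<subseteq> I"
  shows "fin_vec J a = (\<Sum>j\<in>J. a j *\<^sub>R unit_vec j)"
  using assms
proof (induction J)
  case empty
  have "U (fin_vec {} a) = U (0 *\<^sub>R 0)"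
    by (subst U_vec, simp, simp, subst U_scale) simp
  then show ?case using U_inj by fastforce
next
  case (insert k J)
  have "U (fin_vec (insert k J) a) = U (a k *\<^sub>R unit_vec k + fin_vec J a)"
    using insert.prems insert.hyps by (auto simp: U_vec U_add U_scale U_unit fun_eq_iff)
  then have "fin_vec (insert k J) a = a k *\<^sub>R unit_vec k + fin_vec J a"
    by (rule U_inj)
  then show ?case using insert by simp
qed

lemma finite_support_dense:
  assumes "0 < \<epsilon>"
  obtains J where "finite J" "J \<subseteq> I" "norm (x - fin_vec J (U x)) < \<epsilon>"
proof -
  let ?g = "\<lambda>i. \<bar>U x i\<bar> powr p"
  have "(sum ?g \<longlongrightarrow> infsum ?g I) (finite_subsets_at_top I)"
    using U_summable[of x] has_sum_infsum unfolding has_sum_def by blast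
  then have "\<forall>\<^sub>F J in finite_subsets_at_top I. dist (sum ?g J) (infsum ?g I) < \<epsilon> powr p"
    using assms by (intro tendstoD) auto
  then obtain J where J: "finite J" "J \<subseteq> I" "dist (sum ?g J) (infsum ?g I) < \<epsilon> powr p"
    unfolding eventually_finite_subsets_at_top by blast
  have "norm (x - fin_vec J (U x)) powr p = infsum ?g (I - J)"
    unfolding norm_powr U_diff U_vec[OF J(1,2)]
    by (intro infsum_cong_neutral) (use p in auto)
  also have "\<dots> = infsum ?g I - sum ?g J"
    using infsum_Diff[OF U_summable[of x] _ J(2)] J(1) summable_on_finite by fastforce
  also have "\<dots> < \<epsilon> powr p"
    using J(3) unfolding dist_real_def by linarith
  finally have "norm (x - fin_vec J (U x)) < \<epsilon>"
    using assms p powr_mono2[of p \<epsilon> "norm (x - fin_vec J (U x))"] by (auto simp: not_le[symmetric])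
  then show ?thesis using J that by blast
qed

lemma norm_disjoint_powr:
  assumes "i \<in> I" "U u i = 0"
  shows "norm (s *\<^sub>R unit_vec i + u) powr p = \<bar>s\<bar> powr p + norm u powr p"
proof -
  let ?f = "\<lambda>j. \<bar>U (s *\<^sub>R unit_vec i + u) j\<bar> powr p"
  have "norm (s *\<^sub>R unit_vec i + u) powr p = infsum ?f {i} + infsum ?f (I - {i})"
    unfolding norm_powr using infsum_Un_disjoint[of ?f "{i}" "I - {i}"] assms(1)
      summable_on_subset_banach[OF U_summable, of "I - {i}"]
    by (simp add: insert_absorb)
  also have "infsum ?f {i} = \<bar>s\<bar> powr p"
    using assms by (simp add: U_add U_scale U_unit)
  also have "infsum ?f (I - {i}) = norm u powr p"
    unfolding norm_powr
    by (intro infsum_cong_neutral) (use assms p in \<open>auto simp: U_add U_scale U_unit\<close>)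
  finally show ?thesis .
qed

lemma fin_norm_coordinates_le:
  assumes "finite J" "J \<subseteq> I"
  shows "fin_norm p J (U x) \<le> norm x"
proof -
  have A: "(\<Sum>j\<in>J. \<bar>U x j\<bar> powr p) \<le> norm x powr p"
  proof -
    have "(\<Sum>\<^sub>\<infinity>j\<in>J. \<bar>U x j\<bar> powr p) \<le> (\<Sum>\<^sub>\<infinity>j\<in>I. \<bar>U x j\<bar> powr p)"
      using assms U_summable[of x] by (intro infsum_mono_neutral) auto
    then show ?thesis unfolding norm_powr using assms by simp
  qed
  have "fin_norm p J (U x) \<le> (norm x powr p) powr (1 / p)"
    unfolding fin_norm_def using A p by (intro powr_mono2) (auto intro: sum_nonneg)
  then show ?thesis using p by (simp add: powr_powr)
qed

text \<open>The norm of a sum of \<open>n\<close> coordinate functionals in the dual of \<open>\<ell>\<^sub>p\<close>.\<close>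

lemma sum_coord_le:
  assumes "finite J" "J \<subseteq> I"
  shows "\<bar>\<Sum>j\<in>J. U x j\<bar> \<le> real (card J) powr (1 - 1 / p) * norm x"
proof -
  have "(\<Sum>j\<in>J. \<bar>U x j\<bar> * \<bar>1\<bar>) \<le> fin_norm p J (U x) * fin_norm (p / (p - 1)) J (\<lambda>_. 1)"
    using p by (intro Hoelder_sum assms) (auto simp: field_simps)
  also have "\<dots> \<le> norm x * real (card J) powr (1 - 1 / p)"
  proof (intro mult_mono)
    show "fin_norm p J (U x) \<le> norm x" by (rule fin_norm_coordinates_le[OF assms])
    have "1 / (p / (p - 1)) = 1 - 1 / p" using p by (simp add: field_simps)
    then show "fin_norm (p / (p - 1)) J (\<lambda>_. 1) \<le> real (card J) powr (1 - 1 / p)"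
      by (simp add: fin_norm_def)
  qed (auto simp: fin_norm_def)
  finally show ?thesis
    by (intro order_trans[OF sum_abs]) (simp add: mult.commute)
qed

text \<open>The functional is tested at the vector for which Hoelder's inequality is an equality.\<close>

lemma dual_coefficients_le:
  fixes f :: "'l dual"
  assumes J: "finite J" "J \<subseteq> I"
  shows "fin_norm (p / (p - 1)) J (\<lambda>j. blinfun_apply f (unit_vec j)) \<le> norm f"
proof -
  define q where "q = p / (p - 1)"
  have q: "1 < q" "p * (q - 1) = q" "1 / q = 1 - 1 / p" using p by (auto simp: q_def field_simps)
  define a where "a j = blinfun_apply f (unit_vec j)" for j
  define S where "S = (\<Sum>j\<in>J. \<bar>a j\<bar> powr q)"
  have S0: "0 \<le> S" unfolding S_def by (intro sum_nonneg) simp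
  define x where "x = fin_vec J (\<lambda>j. sgn (a j) * \<bar>a j\<bar> powr (q - 1))"
  have "S = blinfun_apply f x"
  proof -
    have "sgn (a j) * \<bar>a j\<bar> powr (q - 1) * a j = \<bar>a j\<bar> powr q" for j
    proof (cases "a j = 0")
      case False
      then have "\<bar>a j\<bar> powr q = \<bar>a j\<bar> powr (q - 1) * \<bar>a j\<bar>"
        using powr_add[of "\<bar>a j\<bar>" "q - 1" 1] by simp
      then show ?thesis by (simp add: abs_sgn mult_ac)
    qed simp
    then show ?thesis
      unfolding x_def vec_eq_sum[OF J] S_def
      by (simp add: blinfun.sum_right blinfun.scaleR_right flip: a_def)
  qed
  also have "\<dots> \<le> norm f * norm x"
    using norm_blinfun[of f x] by simp
  also have "norm x = S powr (1 / p)"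
  proof -
    have "norm x powr p = S"
      unfolding x_def norm_vec_powr[OF J] S_def
      by (intro sum.cong refl) (use q p in \<open>auto simp: abs_mult abs_sgn_eq powr_powr mult.commute\<close>)
    then have "S powr (1 / p) = (norm x powr p) powr (1 / p)" by simp
    then show ?thesis using p by (simp add: powr_powr)
  qed
  finally have le: "S \<le> norm f * S powr (1 / p)" .
  have "S powr (1 / q) \<le> norm f"
  proof (cases "S = 0")
    case False
    have "S powr (1 / q) = S / S powr (1 / p)"
      unfolding q(3) using S0 False by (simp add: powr_diff)
    also have "\<dots> \<le> norm f"
      using le S0 False by (simp add: pos_divide_le_eq)
    finally show ?thesis .
  qed simp
  then show ?thesis unfolding fin_norm_def S_def a_def q_def .
qed

text \<open>A vector that almost norms \<open>f\<close> may be taken finitely supported; then Hoelder's inequality bounds the value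
  of \<open>f\<close> by its coefficients on the support.\<close>

lemma dual_coefficients_ge:
  fixes f :: "'l dual"
  assumes "0 < \<epsilon>"
  obtains J where "finite J" "J \<subseteq> I"
    and "\<And>J'. finite J' \<Longrightarrow> J' \<subseteq> I \<Longrightarrow> J \<subseteq> J' \<Longrightarrow>
      norm f - \<epsilon> \<le> fin_norm (p / (p - 1)) J' (\<lambda>j. blinfun_apply f (unit_vec j))"
proof -
  define q where "q = p / (p - 1)"
  have q: "1 < q" "1 / p + 1 / q = 1" using p by (auto simp: q_def field_simps)
  define a where "a j = blinfun_apply f (unit_vec j)" for j
  have fin: "\<bar>blinfun_apply f (fin_vec J (U x))\<bar> \<le> fin_norm q J a * norm x"
    if J: "finite J" "J \<subseteq> I" for J x
  proof -
    have "\<bar>blinfun_apply f (fin_vec J (U x))\<bar> = \<bar>\<Sum>j\<in>J. U x j * a j\<bar>"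
      unfolding vec_eq_sum[OF J] by (simp add: blinfun.sum_right blinfun.scaleR_right a_def)
    also have "\<dots> \<le> (\<Sum>j\<in>J. \<bar>U x j\<bar> * \<bar>a j\<bar>)"
      by (rule order_trans[OF sum_abs]) (simp add: abs_mult)
    also have "\<dots> \<le> fin_norm p J (U x) * fin_norm q J a"
      using p q by (intro Hoelder_sum J)
    also have "\<dots> \<le> norm x * fin_norm q J a"
      using fin_norm_coordinates_le[OF J] by (intro mult_right_mono) (auto simp: fin_norm_def)
    finally show ?thesis by (simp add: mult.commute)
  qed
  have "\<exists>x. norm x \<le> 1 \<and> norm f - \<epsilon> / 2 < blinfun_apply f x"
  proof (rule ccontr)
    assume "\<not> ?thesis"
    then have A: "blinfun_apply f x \<le> norm f - \<epsilon> / 2" if "norm x \<le> 1" for x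
      using that by (auto simp: not_less)
    have "norm f \<le> norm f - \<epsilon> / 2"
    proof (rule norm_dual_le_of_unit_ball)
      show "blinfun_apply f x \<le> norm f - \<epsilon> / 2" if "norm x \<le> 1" for x by (rule A[OF that])
    qed
    then show False using assms by simp
  qed
  then obtain x where x: "norm x \<le> 1" "norm f - \<epsilon> / 2 < blinfun_apply f x" by blast
  have f1: "0 < \<epsilon> / 2 / (norm f + 1)" using assms by (simp add: add_nonneg_pos)
  obtain J where J: "finite J" "J \<subseteq> I" "norm (x - fin_vec J (U x)) < \<epsilon> / 2 / (norm f + 1)"
    using finite_support_dense[OF f1] by blast
  have "norm f - \<epsilon> \<le> fin_norm q J a"
  proof -
    have "\<bar>blinfun_apply f (x - fin_vec J (U x))\<bar> \<le> norm f * (\<epsilon> / 2 / (norm f + 1))"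
      using norm_blinfun[of f "x - fin_vec J (U x)"] J(3)
      by (intro order_trans[OF _ mult_left_mono[OF less_imp_le[OF J(3)]]]) auto
    also have "\<dots> \<le> \<epsilon> / 2"
    proof -
      have "norm f / (norm f + 1) \<le> 1" by (simp add: divide_le_eq_1 add_nonneg_pos)
      then have "(\<epsilon> / 2) * (norm f / (norm f + 1)) \<le> (\<epsilon> / 2) * 1"
        using assms by (intro mult_left_mono) auto
      then show ?thesis by (simp add: mult_ac)
    qed
    finally have "blinfun_apply f x - \<epsilon> / 2 \<le> blinfun_apply f (fin_vec J (U x))"
      unfolding blinfun.diff_right by linarith
    also have "\<dots> \<le> fin_norm q J a * norm x"
      using fin[OF J(1,2), of x] by simp
    also have "\<dots> \<le> fin_norm q J a"
      using x(1) by (simp add: fin_norm_def mult_left_le)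
    finally show ?thesis using x(2) by simp
  qed
  moreover have "fin_norm q J a \<le> fin_norm q J' a" if "finite J'" "J \<subseteq> J'" for J'
    unfolding fin_norm_def using that q by (intro powr_mono2 sum_mono2) (auto intro: sum_nonneg)
  ultimately have lower: "norm f - \<epsilon> \<le> fin_norm q J' a" if "finite J'" "J \<subseteq> J'" for J'
    using that order_trans by blast
  show ?thesis
  proof (rule that[OF J(1,2)])
    fix J' assume "finite J'" "J \<subseteq> J'"
    then show "norm f - \<epsilon> \<le> fin_norm (p / (p - 1)) J' (\<lambda>j. blinfun_apply f (unit_vec j))"
      using lower unfolding a_def q_def by blast
  qed
qed

end

section \<open>Injective tensor products\<close>

lemma form_of_add: "form_of (u + v) = form_of u + form_of v"
  and form_of_scale: "form_of (c *\<^sub>R u) = c *\<^sub>R form_of u"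
  and form_of_zero: "form_of 0 = 0"
  and norm_form_of: "norm (form_of u) = norm u"
  by (simp_all add: plus_inj_tensor.rep_eq scaleR_inj_tensor.rep_eq zero_inj_tensor.rep_eq norm_inj_tensor.rep_eq)

lemma bounded_linear_form_of: "bounded_linear form_of"
  by (rule bounded_linear_intro[where K = 1]) (auto simp: form_of_add form_of_scale norm_form_of)

lemma dist_form_of: "dist (form_of u) (form_of v) = dist u v"
  unfolding dist_norm norm_form_of[symmetric] minus_inj_tensor.rep_eq ..

text \<open>Density of the algebraic tensor product, as an induction principle.\<close>

lemma inj_tensor_induct [case_names closed add scale tensor]:
  fixes z :: "('a::real_normed_vector, 'b::real_normed_vector) inj_tensor"
  assumes closed: "closed {z. P z}"
    and add: "\<And>u v. P u \<Longrightarrow> P v \<Longrightarrow> P (u + v)"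
    and scale: "\<And>c u. P u \<Longrightarrow> P (c *\<^sub>R u)"
    and tensor: "\<And>x y. P (tensor x y)"
  shows "P z"
proof -
  have span: "\<exists>u. form_of u = w \<and> P u" if "w \<in> span {elem_tensor x y | x y. True}"
    for w :: "'a dual \<Rightarrow>\<^sub>L 'b bidual"
    using that
  proof (induction w rule: span_induct_alt)
    case base
    show ?case using scale[OF tensor, of 0] form_of_zero by fastforce
  next
    case (step c w v)
    then obtain x y u where "w = elem_tensor x y" "form_of u = v" "P u" by blast
    then show ?case
      by (intro exI[of _ "c *\<^sub>R tensor x y + u"])
         (auto simp: form_of_add form_of_scale tensor.rep_eq intro: add scale tensor)
  qed
  have "form_of z \<in> closure (span {elem_tensor x y | x y. True})"
    using form_of[of z] unfolding inj_tensor_carrier_def .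
  then obtain w where w: "\<And>n. w n \<in> span {elem_tensor x y | x y. True}" "w \<longlonglongrightarrow> form_of z"
    unfolding closure_sequential by blast
  obtain u where u: "\<And>n. form_of (u n) = w n" "\<And>n. P (u n)"
    using span[OF w(1)] by metis
  have "u \<longlonglongrightarrow> z"
    using w(2) unfolding tendsto_iff u(1)[symmetric] dist_form_of .
  then show "P z"
    using closed_sequentially[OF closed, of u] u(2) by blast
qed

lemma form_of_tensor [simp]: "blinfun_apply (blinfun_apply (form_of (tensor x y)) f) g = blinfun_apply f x * blinfun_apply g y"
  by (simp add: tensor.rep_eq)

lemma form_of_le:
  shows "norm (blinfun_apply (form_of z) f) \<le> norm z * norm f"
    and "\<bar>blinfun_apply (blinfun_apply (form_of z) f) g\<bar> \<le> norm z * norm f * norm g"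
proof -
  show 1: "norm (blinfun_apply (form_of z) f) \<le> norm z * norm f"
    using norm_blinfun[of "form_of z" f] by (simp add: norm_form_of)
  have "\<bar>blinfun_apply (blinfun_apply (form_of z) f) g\<bar> \<le> norm (blinfun_apply (form_of z) f) * norm g"
    using norm_blinfun[of "blinfun_apply (form_of z) f" g] by simp
  also have "\<dots> \<le> norm z * norm f * norm g"
    using 1 by (intro mult_right_mono) auto
  finally show "\<bar>blinfun_apply (blinfun_apply (form_of z) f) g\<bar> \<le> norm z * norm f * norm g" .
qed

lemma norm_inj_tensor_le:
  assumes "0 \<le> c" "\<And>f g. \<bar>blinfun_apply (blinfun_apply (form_of z) f) g\<bar> \<le> c * norm f * norm g"
  shows "norm z \<le> c"
  unfolding norm_form_of[symmetric] using assms
  by (intro norm_blinfun_bound) auto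

lemma norm_tensor_le: "norm (tensor x y) \<le> norm x * norm y"
proof (rule norm_inj_tensor_le)
  show "\<bar>blinfun_apply (blinfun_apply (form_of (tensor x y)) f) g\<bar> \<le> norm x * norm y * norm f * norm g" for f g
    using mult_mono[OF norm_blinfun[of f x] norm_blinfun[of g y]]
    by (simp add: abs_mult mult_ac)
qed simp

text \<open>A form in the tensor product is an operator with values in the bidual of the second factor; this says
  that its values come from the second factor itself.\<close>

lemma form_of_in_closure_range_embed:
  "blinfun_apply (form_of z) f \<in> closure (range bidual_embed)"
proof (induction z rule: inj_tensor_induct)
  case closed
  have "bounded_linear (\<lambda>z. blinfun_apply (form_of z) f)"
    by (rule bounded_linear_compose[OF bounded_bilinear.bounded_linear_left[OF bounded_bilinear_blinfun_apply] bounded_linear_form_of])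
  then have "continuous_on UNIV (\<lambda>z. blinfun_apply (form_of z) f)"
    by (rule linear_continuous_on)
  then show ?case
    using closed_vimage[OF closed_closure] by (simp add: vimage_def)
next
  case (add u v)
  then show ?case
    using closure_span_add[of _ "range bidual_embed"]
    by (simp add: form_of_add blinfun.add_left span_range_bidual_embed)
next
  case (scale c u)
  then show ?case
    using closure_span_scale[of _ "range bidual_embed"]
    by (simp add: form_of_scale blinfun.scaleR_left span_range_bidual_embed)
next
  case (tensor x y)
  have "blinfun_apply (form_of (tensor x y)) f = bidual_embed (blinfun_apply f x *\<^sub>R y)"
    by (rule blinfun_eqI) (simp add: blinfun.scaleR_right)
  then show ?case
    using closure_subset[of "range bidual_embed"] by auto
qed

lemma inj_tensor_trivial:
  fixes z :: "('a::real_normed_vector, 'b::real_normed_vector) inj_tensor"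
  assumes "\<And>y::'b. norm y \<noteq> 1"
  shows "z = 0"
proof -
  have triv: "y = 0" for y :: 'b
  proof (rule ccontr)
    assume "y \<noteq> 0"
    then have "norm (inverse (norm y) *\<^sub>R y) = 1" by simp
    then show False using assms by blast
  qed
  show ?thesis
  proof (induction z rule: inj_tensor_induct)
    case (tensor x y)
    show ?case using norm_tensor_le[of x y] triv[of y] by simp
  qed auto
qed


lemma inj_tensor_eqI:
  assumes "\<And>f g. blinfun_apply (blinfun_apply (form_of u) f) g = blinfun_apply (blinfun_apply (form_of v) f) g"
  shows "u = v"
proof -
  have "form_of u = form_of v"
    by (rule blinfun_eqI, rule blinfun_eqI, rule assms)
  then show ?thesis by (simp only: form_of_inject)
qed

text \<open>The Banach space adjoint.\<close>

definition dual_map ::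
    "('a::real_normed_vector \<Rightarrow>\<^sub>L 'c::real_normed_vector) \<Rightarrow> 'c dual \<Rightarrow>\<^sub>L 'a dual"
  where "dual_map r = Blinfun (\<lambda>f. f o\<^sub>L r)"

lemma dual_map_apply [simp]: "blinfun_apply (dual_map r) f = f o\<^sub>L r"
  unfolding dual_map_def
  by (subst bounded_linear_Blinfun_apply[OF
      bounded_bilinear.bounded_linear_left[OF bounded_bilinear_blinfun_compose]]) (rule refl)

text \<open>The operator \<open>r \<otimes> id\<close>.  On forms it is composition with the adjoint of \<open>r\<close>, which respects elementary
  tensors and therefore the closure of their span.\<close>

lift_definition tensor_map ::
    "('a::real_normed_vector \<Rightarrow>\<^sub>L 'c::real_normed_vector) \<Rightarrow>
      ('a, 'b::real_normed_vector) inj_tensor \<Rightarrow> ('c, 'b) inj_tensor"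
  is "\<lambda>r B. B o\<^sub>L dual_map r"
proof -
  fix r :: "'a \<Rightarrow>\<^sub>L 'c" and B :: "'a dual \<Rightarrow>\<^sub>L 'b bidual"
  let ?F = "\<lambda>B :: 'a dual \<Rightarrow>\<^sub>L 'b bidual. B o\<^sub>L dual_map r"
  have bl: "bounded_linear ?F"
    by (rule bounded_bilinear.bounded_linear_left[OF bounded_bilinear_blinfun_compose])
  have "?F (elem_tensor x y) = elem_tensor (blinfun_apply r x) y" for x y
    by (rule blinfun_eqI, rule blinfun_eqI) simp
  then have img: "?F ` {elem_tensor x y | x y. True} \<subseteq> {elem_tensor x y | x y. True}"
    by auto
  assume "B \<in> inj_tensor_carrier"
  then have "?F B \<in> ?F ` closure (span {elem_tensor x y | x y. True})"
    unfolding inj_tensor_carrier_def by (rule imageI)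
  also have "\<dots> \<subseteq> closure (?F ` span {elem_tensor x y | x y. True})"
    by (rule closure_bounded_linear_image_subset[OF bl])
  also have "?F ` span {elem_tensor x y | x y. True} = span (?F ` {elem_tensor x y | x y. True})"
    by (rule linear_span_image[OF bounded_linear.linear[OF bl], symmetric])
  also have "closure (span (?F ` {elem_tensor x y | x y. True})) \<subseteq> closure (span {elem_tensor x y | x y. True})"
    by (intro closure_mono span_mono img)
  finally show "?F B \<in> inj_tensor_carrier"
    unfolding inj_tensor_carrier_def .
qed

lemma form_of_tensor_map [simp]: "blinfun_apply (form_of (tensor_map r z)) f = blinfun_apply (form_of z) (f o\<^sub>L r)"
  by (simp add: tensor_map.rep_eq)

lemma tensor_map_tensor: "tensor_map r (tensor x y) = tensor (blinfun_apply r x) y"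
  by (rule inj_tensor_eqI) simp

lemma bounded_linear_tensor_map:
  fixes r :: "'a::real_normed_vector \<Rightarrow>\<^sub>L 'c::real_normed_vector"
  shows "bounded_linear (tensor_map r :: ('a, 'b::real_normed_vector) inj_tensor \<Rightarrow> _)"
proof (rule bounded_linear_intro[where K = "norm r"])
  show "tensor_map r (u + v) = tensor_map r u + tensor_map r v" for u v :: "('a, 'b) inj_tensor"
    by (rule inj_tensor_eqI) (simp add: form_of_add blinfun.add_left)
  show "tensor_map r (c *\<^sub>R u) = c *\<^sub>R tensor_map r u" for c and u :: "('a, 'b) inj_tensor"
    by (rule inj_tensor_eqI) (simp add: form_of_scale blinfun.scaleR_left)
  show "norm (tensor_map r u) \<le> norm u * norm r" for u :: "('a, 'b) inj_tensor"
  proof (rule norm_inj_tensor_le)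
    fix f :: "'c dual" and g :: "'b dual"
    have "norm u * norm (f o\<^sub>L r) * norm g \<le> norm u * (norm f * norm r) * norm g"
      by (intro mult_right_mono mult_left_mono norm_blinfun_compose) auto
    then show "\<bar>blinfun_apply (blinfun_apply (form_of (tensor_map r u)) f) g\<bar> \<le> norm u * norm r * norm f * norm g"
      using form_of_le(2)[of u "f o\<^sub>L r" g] by (simp add: mult_ac)
  qed simp
qed

lemma bounded_linear_tensor: "bounded_linear (tensor x)"
proof (rule bounded_linear_intro[where K = "norm x"])
  show "tensor x (y + y') = tensor x y + tensor x y'" for y y'
    by (rule inj_tensor_eqI) (simp add: form_of_add blinfun.add_left blinfun.add_right distrib_left)
  show "tensor x (c *\<^sub>R y) = c *\<^sub>R tensor x y" for c y
    by (rule inj_tensor_eqI) (simp add: form_of_scale blinfun.scaleR_left blinfun.scaleR_right)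
  show "norm (tensor x y) \<le> norm y * norm x" for y
    using norm_tensor_le[of x y] by (simp add: mult.commute)
qed

definition tensor_dual ::
    "'a::real_normed_vector dual \<Rightarrow> 'b::real_normed_vector dual \<Rightarrow> ('a, 'b) inj_tensor dual"
  where "tensor_dual f g = Blinfun (\<lambda>z. blinfun_apply (blinfun_apply (form_of z) f) g)"

lemma tensor_dual_apply [simp]:
  "blinfun_apply (tensor_dual f g) z = blinfun_apply (blinfun_apply (form_of z) f) g"
proof -
  have "bounded_linear (\<lambda>z. blinfun_apply (blinfun_apply (form_of z) f) g)"
  proof (rule bounded_linear_intro[where K = "norm f * norm g"])
    show "norm (blinfun_apply (blinfun_apply (form_of z) f) g) \<le> norm z * (norm f * norm g)" for z
      using form_of_le(2)[of z f g] by (simp add: mult.assoc)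
  qed (simp_all add: form_of_add form_of_scale blinfun.add_left blinfun.scaleR_left)
  then show ?thesis
    unfolding tensor_dual_def by (simp add: bounded_linear_Blinfun_apply)
qed

lemma norm_tensor_dual_le: "norm (tensor_dual f g) \<le> norm f * norm g"
proof (rule norm_blinfun_bound)
  show "norm (blinfun_apply (tensor_dual f g) z) \<le> norm f * norm g * norm z" for z
    using form_of_le(2)[of z f g] by (simp add: mult_ac)
qed simp

text \<open>The tensor product maps to its second factor by \<open>x \<otimes> y \<mapsto> f x * y\<close>; this is the second adjoint of that
  map.\<close>

definition slice ::
    "('a::real_normed_vector, 'b::real_normed_vector) inj_tensor bidual \<Rightarrow> 'a dual \<Rightarrow> 'b bidual"
  where "slice T f = Blinfun (\<lambda>g. blinfun_apply T (tensor_dual f g))"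

lemma slice_apply [simp]:
  fixes f :: "'a::real_normed_vector dual" and g :: "'b::real_normed_vector dual"
  shows "blinfun_apply (slice T f) g = blinfun_apply T (tensor_dual f g)"
proof -
  have "bounded_linear (\<lambda>g. blinfun_apply T (tensor_dual f g))"
  proof (rule bounded_linear_intro[where K = "norm T * norm f"])
    have "tensor_dual f (g + h) = tensor_dual f g + tensor_dual f h" for g h :: "'b dual"
      by (rule blinfun_eqI) (simp add: blinfun.add_left blinfun.add_right)
    then show "blinfun_apply T (tensor_dual f (g + h)) =
        blinfun_apply T (tensor_dual f g) + blinfun_apply T (tensor_dual f h)" for g h
      by (simp add: blinfun.add_right)
    have "tensor_dual f (c *\<^sub>R g) = c *\<^sub>R tensor_dual f g" for c and g :: "'b dual"
      by (rule blinfun_eqI) (simp add: blinfun.scaleR_left blinfun.scaleR_right)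
    then show "blinfun_apply T (tensor_dual f (c *\<^sub>R g)) = c *\<^sub>R blinfun_apply T (tensor_dual f g)" for c g
      by (simp add: blinfun.scaleR_right)
    show "norm (blinfun_apply T (tensor_dual f g)) \<le> norm g * (norm T * norm f)" for g
    proof -
      have "norm (blinfun_apply T (tensor_dual f g)) \<le> norm T * norm (tensor_dual f g)"
        by (rule norm_blinfun)
      also have "\<dots> \<le> norm T * (norm f * norm g)"
        by (intro mult_left_mono norm_tensor_dual_le) simp
      finally show ?thesis by (simp add: mult_ac)
    qed
  qed
  then show ?thesis
    unfolding slice_def by (simp add: bounded_linear_Blinfun_apply)
qed

lemma norm_slice_le:
  fixes T :: "('a::real_normed_vector, 'b::real_normed_vector) inj_tensor bidual"
  shows "norm (slice T f) \<le> norm T * norm f"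
proof (rule norm_blinfun_bound)
  fix g
  have "norm (blinfun_apply (slice T f) g) \<le> norm T * norm (tensor_dual f g)"
    by (simp only: slice_apply norm_blinfun)
  also have "\<dots> \<le> norm T * (norm f * norm g)"
    by (intro mult_left_mono norm_tensor_dual_le) simp
  finally show "norm (blinfun_apply (slice T f) g) \<le> norm T * norm f * norm g"
    by (simp add: mult.assoc)
qed simp

lemma slice_sum:
  fixes T :: "('a::real_normed_vector, 'b::real_normed_vector) inj_tensor bidual"
  shows "slice T (\<Sum>k\<in>K. f k) = (\<Sum>k\<in>K. slice T (f k))"
proof (rule blinfun_eqI)
  fix g :: "'b dual"
  have "tensor_dual (\<Sum>k\<in>K. f k) g = (\<Sum>k\<in>K. tensor_dual (f k) g)"
    by (rule blinfun_eqI) (simp add: blinfun.sum_left blinfun.sum_right)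
  then show "blinfun_apply (slice T (\<Sum>k\<in>K. f k)) g = blinfun_apply (\<Sum>k\<in>K. slice T (f k)) g"
    by (simp add: blinfun.sum_left blinfun.sum_right)
qed

section \<open>Octahedrality of the tensor product\<close>

text \<open>The definition of an octahedral norm speaks of unit vectors; the passage to \<open>v k\<close> and \<open>c k\<close> of arbitrary
  size is the observation that \<open>|x + u| \<approx> 2\<close> forces \<open>|t u + s x| \<approx> t + s\<close> for all \<open>s, t \<ge> 0\<close>.\<close>

lemma octahedral_step:
  fixes v :: "'k \<Rightarrow> 'a::real_normed_vector" and c :: "'k \<Rightarrow> real"
  assumes oct: "octahedral TYPE('a)" and K: "finite K" and \<delta>: "0 < \<delta>" and e: "norm (e::'a) = 1"
  obtains x :: 'a where "norm x \<le> 1" "\<And>k. k \<in> K \<Longrightarrow> norm (v k) + \<bar>c k\<bar> - \<delta> \<le> norm (v k + c k *\<^sub>R x)"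
proof -
  define R where "R = 1 + (\<Sum>k\<in>K. norm (v k) + \<bar>c k\<bar>)"
  have R: "0 < R" unfolding R_def by (intro add_pos_nonneg sum_nonneg) auto
  have le_R: "norm (v k) \<le> R" "\<bar>c k\<bar> \<le> R" if "k \<in> K" for k
  proof -
    have "norm (v k) + \<bar>c k\<bar> \<le> (\<Sum>k\<in>K. norm (v k) + \<bar>c k\<bar>)"
      by (rule member_le_sum[OF that _ K]) auto
    then show "norm (v k) \<le> R" "\<bar>c k\<bar> \<le> R"
      using norm_ge_zero[of "v k"] unfolding R_def by linarith+
  qed
  \<comment> \<open>In the degenerate cases any unit vector serves.\<close>
  define u where "u k = (if v k = 0 \<or> c k = 0 then e else (sgn (c k) / norm (v k)) *\<^sub>R v k)" for k
  have u1: "norm (u k) = 1" for k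
    unfolding u_def using e by (auto simp: abs_sgn_eq)
  obtain h where h: "bij_betw h {1..card K} K"
    using ex_bij_betw_nat_finite_1[OF K] by blast
  have "\<exists>x\<in>cball 0 1. \<forall>i\<in>{1..card K}. norm (x + u (h i)) > 2 - \<delta> / R"
    using oct[unfolded octahedral_def, rule_format, of "card K" "\<lambda>i. u (h i)" "\<delta> / R"] u1 \<delta> R by simp
  then obtain x where x: "norm x \<le> 1" "\<And>i. i \<in> {1..card K} \<Longrightarrow> norm (x + u (h i)) > 2 - \<delta> / R"
    by auto
  have xu: "norm (x + u k) > 2 - \<delta> / R" if "k \<in> K" for k
    using x(2) bij_betw_imp_surj_on[OF h] that by force
  show ?thesis
  proof (rule that[OF x(1)])
    fix k assume k: "k \<in> K"
    define s t where "s = \<bar>c k\<bar>" and "t = norm (v k)"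
    have st: "0 \<le> s" "0 \<le> t" "s \<le> R" "t \<le> R"
      using le_R[OF k] by (auto simp: s_def t_def)
    have small: "r * (2 - \<delta> / R) \<ge> 2 * r - \<delta>" if "0 \<le> r" "r \<le> R" for r
    proof -
      have "r / R * \<delta> \<le> 1 * \<delta>" using that R \<delta> by (intro mult_right_mono) auto
      then show ?thesis by (simp add: algebra_simps)
    qed
    have "s + t - \<delta> \<le> norm (t *\<^sub>R u k + s *\<^sub>R x)"
    proof (cases "t \<le> s")
      case True
      have "2 * s - \<delta> \<le> s * norm (x + u k)"
        using st mult_left_mono[OF less_imp_le[OF xu[OF k]]] by (intro order_trans[OF small]) auto
      also have "\<dots> = norm ((t *\<^sub>R u k + s *\<^sub>R x) + (s - t) *\<^sub>R u k)"
        using st(1) by (simp add: algebra_simps flip: norm_scaleR[of s "x + u k", simplified abs_of_nonneg[OF st(1)]])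
      also have "\<dots> \<le> norm (t *\<^sub>R u k + s *\<^sub>R x) + (s - t)"
        by (rule order_trans[OF norm_triangle_ineq]) (use True u1 in simp)
      finally show ?thesis by simp
    next
      case False
      have "2 * t - \<delta> \<le> t * norm (x + u k)"
        using st mult_left_mono[OF less_imp_le[OF xu[OF k]]] by (intro order_trans[OF small]) auto
      also have "\<dots> = norm ((t *\<^sub>R u k + s *\<^sub>R x) + (t - s) *\<^sub>R x)"
        using st(2) by (simp add: algebra_simps flip: norm_scaleR[of t "x + u k", simplified abs_of_nonneg[OF st(2)]])
      also have "\<dots> \<le> norm (t *\<^sub>R u k + s *\<^sub>R x) + (t - s)"
      proof (rule order_trans[OF norm_triangle_ineq], rule add_left_mono)
        show "norm ((t - s) *\<^sub>R x) \<le> t - s"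
          using False x(1) by (simp add: mult_left_le)
      qed
      finally show ?thesis by simp
    qed
    also have "norm (t *\<^sub>R u k + s *\<^sub>R x) = norm (v k + c k *\<^sub>R x)"
    proof (cases "v k = 0 \<or> c k = 0")
      case True
      then show ?thesis by (auto simp: s_def t_def u1)
    next
      case False
      then have "t *\<^sub>R u k + s *\<^sub>R x = sgn (c k) *\<^sub>R (v k + c k *\<^sub>R x)"
        by (simp add: s_def t_def u_def algebra_simps abs_sgn mult.commute)
      then show ?thesis using False by (simp add: abs_sgn_eq)
    qed
    finally show "norm (v k) + \<bar>c k\<bar> - \<delta> \<le> norm (v k + c k *\<^sub>R x)"
      by (simp add: s_def t_def)
  qed
qed

text \<open>Each \<open>\<theta>\<close> of the list receives a vector of the unit ball, chosen by \<open>octahedral_step\<close> after the previous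
  ones have been added to the \<open>v k\<close>; the vectors span an almost isometric copy of \<open>\<ell>\<^sub>1\<close> as far as the given
  finitely many combinations are concerned.\<close>

lemma octahedral_l1_sum:
  fixes v :: "'k \<Rightarrow> 'a::real_normed_vector" and c :: "'c \<Rightarrow> 'k \<Rightarrow> real"
  assumes oct: "octahedral TYPE('a)" and K: "finite K" and e: "norm (e::'a) = 1" and \<delta>: "0 < \<delta>"
  shows "\<exists>ps :: ('c \<times> 'a) list. map fst ps = xs \<and> (\<forall>(\<theta>, y)\<in>set ps. norm y \<le> 1) \<and>
    (\<forall>k\<in>K. norm (v k) + (\<Sum>\<theta>\<leftarrow>xs. \<bar>c \<theta> k\<bar>) - \<delta> \<le> norm (v k + (\<Sum>(\<theta>, y)\<leftarrow>ps. c \<theta> k *\<^sub>R y)))"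
  using \<delta>
proof (induction xs arbitrary: v \<delta>)
  case Nil
  then show ?case by (intro exI[of _ "[]"]) simp
next
  case (Cons \<theta> xs)
  then have \<delta>2: "0 < \<delta> / 2" by simp
  obtain x where x: "norm x \<le> 1"
    "\<And>k. k \<in> K \<Longrightarrow> norm (v k) + \<bar>c \<theta> k\<bar> - \<delta> / 2 \<le> norm (v k + c \<theta> k *\<^sub>R x)"
    using octahedral_step[OF oct K \<delta>2 e, of v "c \<theta>"] by blast
  obtain ps where ps: "map fst ps = xs" "\<forall>(\<theta>, y)\<in>set ps. norm y \<le> 1"
    "\<forall>k\<in>K. norm (v k + c \<theta> k *\<^sub>R x) + (\<Sum>\<theta>\<leftarrow>xs. \<bar>c \<theta> k\<bar>) - \<delta> / 2
      \<le> norm (v k + c \<theta> k *\<^sub>R x + (\<Sum>(\<theta>, y)\<leftarrow>ps. c \<theta> k *\<^sub>R y))"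
    using Cons.IH[OF \<delta>2, of "\<lambda>k. v k + c \<theta> k *\<^sub>R x"] by blast
  show ?case
  proof (intro exI[of _ "(\<theta>, x) # ps"] conjI ballI)
    fix k assume k: "k \<in> K"
    show "norm (v k) + (\<Sum>\<theta>\<leftarrow>\<theta> # xs. \<bar>c \<theta> k\<bar>) - \<delta>
        \<le> norm (v k + (\<Sum>(\<theta>, y)\<leftarrow>(\<theta>, x) # ps. c \<theta> k *\<^sub>R y))"
      using ps(3)[rule_format, OF k] x(2)[OF k] by (simp add: add.assoc)
  qed (use ps x in auto)
qed

context lp_isometry
begin

lemma form_of_l1_tensor:
  fixes ps :: "(('i \<Rightarrow> real) \<times> 'a::real_normed_vector) list"
  assumes J: "finite J" "J \<subseteq> I"
  shows "blinfun_apply (form_of (\<Sum>(\<theta>, y)\<leftarrow>ps. tensor (fin_vec J \<theta>) y)) f =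
    bidual_embed (\<Sum>(\<theta>, y)\<leftarrow>ps. (\<Sum>j\<in>J. \<theta> j * blinfun_apply f (unit_vec j)) *\<^sub>R y)"
proof (induction ps)
  case Nil
  show ?case by (rule blinfun_eqI) (simp add: form_of_zero blinfun.zero_right)
next
  case (Cons \<theta>y ps)
  obtain \<theta> y where [simp]: "\<theta>y = (\<theta>, y)" by (cases \<theta>y)
  have "blinfun_apply (form_of (tensor (fin_vec J \<theta>) y)) f =
      bidual_embed ((\<Sum>j\<in>J. \<theta> j * blinfun_apply f (unit_vec j)) *\<^sub>R y)"
    by (rule blinfun_eqI)
       (simp add: vec_eq_sum[OF J] blinfun.sum_right blinfun.scaleR_right)
  then show ?case
    using Cons.IH by (simp add: form_of_add blinfun.add_left bidual_embed_add)
qed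

text \<open>The sum of tensors is the operator that maps \<open>\<ell>\<^sub>q\<^sup>J\<close> into \<open>\<ell>\<^sub>1\<close> by the forms \<open>\<theta>\<close> and then \<open>\<ell>\<^sub>1\<close> into the
  second factor.  Both maps are contractions.\<close>

lemma norm_l1_tensor_le:
  fixes ps :: "(('i \<Rightarrow> real) \<times> 'a::real_normed_vector) list"
  assumes J: "finite J" "J \<subseteq> I" and ps: "\<forall>(\<theta>, y)\<in>set ps. norm y \<le> 1"
    and le: "\<And>a. (\<Sum>\<theta>\<leftarrow>map fst ps. \<bar>\<Sum>j\<in>J. \<theta> j * a j\<bar>) \<le> fin_norm (p / (p - 1)) J a"
  shows "norm (\<Sum>(\<theta>, y)\<leftarrow>ps. tensor (fin_vec J \<theta>) y) \<le> 1"
  unfolding norm_form_of[symmetric]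
proof (rule norm_blinfun_le_of_unit_ball)
  fix f :: "'l dual" assume f: "norm f \<le> 1"
  define a where "a j = blinfun_apply f (unit_vec j)" for j
  have "norm (\<Sum>(\<theta>, y)\<leftarrow>ps. (\<Sum>j\<in>J. \<theta> j * a j) *\<^sub>R y) \<le> (\<Sum>\<theta>\<leftarrow>map fst ps. \<bar>\<Sum>j\<in>J. \<theta> j * a j\<bar>)"
    using ps
  proof (induction ps)
    case (Cons \<theta>y ps)
    obtain \<theta> y where [simp]: "\<theta>y = (\<theta>, y)" by (cases \<theta>y)
    have "norm ((\<Sum>j\<in>J. \<theta> j * a j) *\<^sub>R y) \<le> \<bar>\<Sum>j\<in>J. \<theta> j * a j\<bar>"
      using Cons.prems by (simp add: mult_left_le)
    moreover have "norm (\<Sum>(\<theta>, y)\<leftarrow>ps. (\<Sum>j\<in>J. \<theta> j * a j) *\<^sub>R y) \<le> (\<Sum>\<theta>\<leftarrow>map fst ps. \<bar>\<Sum>j\<in>J. \<theta> j * a j\<bar>)"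
      using Cons by simp
    ultimately show ?case
      by (simp del: norm_scaleR add: norm_triangle_mono)
  qed simp
  also have "\<dots> \<le> fin_norm (p / (p - 1)) J a" by (rule le)
  also have "\<dots> \<le> norm f" unfolding a_def by (rule dual_coefficients_le[OF J])
  also have "\<dots> \<le> 1" by (rule f)
  finally show "norm (blinfun_apply (form_of (\<Sum>(\<theta>, y)\<leftarrow>ps. tensor (fin_vec J \<theta>) y)) f) \<le> 1"
    unfolding form_of_l1_tensor[OF J] norm_bidual_embed a_def .
qed

lemma octahedral_inj_tensor:
  assumes oct: "octahedral TYPE('a::real_normed_vector)" and p2: "2 < p"
  shows "octahedral TYPE(('l, 'a) inj_tensor)"
  unfolding octahedral_def
proof (intro allI impI)
  fix n :: nat and z :: "nat \<Rightarrow> ('l, 'a) inj_tensor" and \<epsilon> :: real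
  assume A: "(\<forall>i\<in>{1..n}. z i \<in> sphere 0 1) \<and> 0 < \<epsilon>"
  then have z: "norm (z i) = 1" if "i \<in> {1..n}" for i
    using that by (simp add: dist_norm)
  show "\<exists>y\<in>cball 0 1. \<forall>i\<in>{1..n}. 2 - \<epsilon> < norm (y + z i)"
  proof (cases "n = 0")
    case True
    then show ?thesis by (intro bexI[of _ 0]) auto
  next
    case False
    then have "z 1 \<noteq> 0" using z[of 1] by auto
    then obtain e :: 'a where e: "norm e = 1"
      using inj_tensor_trivial by blast
    \<comment> \<open>The estimates below lose seven times this amount.\<close>
    define \<delta> where "\<delta> = \<epsilon> / 8"
    have \<delta>: "0 < \<delta>" using A by (simp add: \<delta>_def)
    have "\<exists>f. norm f \<le> 1 \<and> 1 - \<delta> < norm (blinfun_apply (form_of (z i)) f)" if i: "i \<in> {1..n}" for i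
    proof (rule ccontr)
      assume "\<not> ?thesis"
      then have "norm (blinfun_apply (form_of (z i)) f) \<le> 1 - \<delta>" if "norm f \<le> 1" for f
        using that by (auto simp: not_less)
      then have "norm (form_of (z i)) \<le> 1 - \<delta>"
        by (rule norm_blinfun_le_of_unit_ball)
      then show False using z[OF i] \<delta> by (simp add: norm_form_of)
    qed
    then obtain f where f: "\<And>i. i \<in> {1..n} \<Longrightarrow> norm (f i) \<le> 1"
      "\<And>i. i \<in> {1..n} \<Longrightarrow> 1 - \<delta> < norm (blinfun_apply (form_of (z i)) (f i))"
      by metis
    have f_lower: "1 - \<delta> < norm (f i)" if i: "i \<in> {1..n}" for i
      using form_of_le(1)[of "z i" "f i"] f(2)[OF i] z[OF i] by simp
    have "\<exists>x. dist (bidual_embed x) (blinfun_apply (form_of (z i)) (f i)) < \<delta>" for i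
      using form_of_in_closure_range_embed[of "z i" "f i"] \<delta> unfolding closure_approachable by blast
    then obtain v where v: "\<And>i. norm (bidual_embed (v i) - blinfun_apply (form_of (z i)) (f i)) < \<delta>"
      unfolding dist_norm by metis
    have v_lower: "1 - 2 * \<delta> \<le> norm (v i)" if i: "i \<in> {1..n}" for i
      using norm_triangle_ineq2[of "blinfun_apply (form_of (z i)) (f i)" "bidual_embed (v i)"]
        v[of i] f(2)[OF i] by (simp add: norm_minus_commute)
    have "\<exists>J. finite J \<and> J \<subseteq> I \<and> (\<forall>J'. finite J' \<longrightarrow> J' \<subseteq> I \<longrightarrow> J \<subseteq> J' \<longrightarrow>
        norm (f i) - \<delta> \<le> fin_norm (p / (p - 1)) J' (\<lambda>j. blinfun_apply (f i) (unit_vec j)))" for i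
      using dual_coefficients_ge[OF \<delta>, of "f i"] by metis
    then obtain J where J: "\<And>i. finite (J i)" "\<And>i. J i \<subseteq> I"
      "\<And>i J'. finite J' \<Longrightarrow> J' \<subseteq> I \<Longrightarrow> J i \<subseteq> J' \<Longrightarrow>
        norm (f i) - \<delta> \<le> fin_norm (p / (p - 1)) J' (\<lambda>j. blinfun_apply (f i) (unit_vec j))"
      by metis
    define F where "F = (\<Union>i\<in>{1..n}. J i)"
    have F: "finite F" "F \<subseteq> I" unfolding F_def using J by auto
    define q where "q = p / (p - 1)"
    have q: "1 < q" "q < 2" using p2 by (auto simp: q_def field_simps)
    define a where "a i j = blinfun_apply (f i) (unit_vec j)" for i j
    have a_le: "fin_norm q F (a i) \<le> 1" if "i \<in> {1..n}" for i
      using dual_coefficients_le[OF F, of "f i"] f(1)[OF that] unfolding a_def q_def by simp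
    have a_ge: "1 - 2 * \<delta> \<le> fin_norm q F (a i)" if i: "i \<in> {1..n}" for i
    proof -
      have "J i \<subseteq> F" using i unfolding F_def by blast
      then show ?thesis
        using J(3)[OF F, of i] f_lower[OF i] unfolding a_def q_def by simp
    qed
    \<comment> \<open>A contraction into l_1 that almost preserves the norms of the coefficient vectors of all f i.\<close>
    obtain xs where xs: "\<And>b. (\<Sum>\<theta>\<leftarrow>xs. \<bar>\<Sum>j\<in>F. \<theta> j * b j\<bar>) \<le> fin_norm q F b"
      "\<And>b. b \<in> a ` {1..n} \<Longrightarrow> fin_norm q F b \<le> 1 \<Longrightarrow> fin_norm q F b - \<delta> \<le> (\<Sum>\<theta>\<leftarrow>xs. \<bar>\<Sum>j\<in>F. \<theta> j * b j\<bar>)"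
      by (rule lq_almost_isometric_in_l1[OF F(1) q _ \<delta>, of "a ` {1..n}"]) auto
    from octahedral_l1_sum[OF oct finite_atLeastAtMost[of 1 n] e \<delta>,
        where xs = xs and v = v and c = "\<lambda>\<theta> i. \<Sum>j\<in>F. \<theta> j * a i j"]
    obtain ps :: "(('i \<Rightarrow> real) \<times> 'a) list" where ps: "map fst ps = xs" "\<forall>(\<theta>, y)\<in>set ps. norm y \<le> 1"
      "\<forall>i\<in>{1..n}. norm (v i) + (\<Sum>\<theta>\<leftarrow>xs. \<bar>\<Sum>j\<in>F. \<theta> j * a i j\<bar>) - \<delta>
        \<le> norm (v i + (\<Sum>(\<theta>, y)\<leftarrow>ps. (\<Sum>j\<in>F. \<theta> j * a i j) *\<^sub>R y))"
      by (elim exE conjE) (rule that)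
    define S where "S = (\<Sum>(\<theta>, y)\<leftarrow>ps. tensor (fin_vec F \<theta>) y)"
    have "norm S \<le> 1"
      unfolding S_def
      by (rule norm_l1_tensor_le[OF F ps(2)]) (unfold ps(1), rule xs(1)[unfolded q_def])
    moreover have "2 - \<epsilon> < norm (S + z i)" if i: "i \<in> {1..n}" for i
    proof -
      let ?w = "\<Sum>(\<theta>, y)\<leftarrow>ps. (\<Sum>j\<in>F. \<theta> j * a i j) *\<^sub>R y"
      let ?b = "blinfun_apply (form_of (z i)) (f i)"
      have "2 - 6 * \<delta> \<le> norm (v i + ?w)"
        using ps(3)[rule_format, OF i] v_lower[OF i] a_ge[OF i] xs(2)[OF imageI[OF i] a_le[OF i]]
        by linarith
      also have "\<dots> = norm ((bidual_embed ?w + ?b) + (bidual_embed (v i) - ?b))"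
      proof -
        have eq: "bidual_embed (v i + ?w) = (bidual_embed ?w + ?b) + (bidual_embed (v i) - ?b)"
          by (simp add: bidual_embed_add)
        show ?thesis
          unfolding eq[symmetric] by (rule norm_bidual_embed[symmetric])
      qed
      also have "\<dots> \<le> norm (bidual_embed ?w + ?b) + \<delta>"
        using v[of i] by (intro order_trans[OF norm_triangle_ineq]) auto
      also have "bidual_embed ?w + ?b = blinfun_apply (form_of (S + z i)) (f i)"
        unfolding S_def form_of_add blinfun.add_left form_of_l1_tensor[OF F] a_def ..
      also have "norm \<dots> \<le> norm (S + z i) * norm (f i)"
        by (rule form_of_le)
      also have "\<dots> \<le> norm (S + z i)"
        using f(1)[OF i] by (intro mult_left_le) auto
      finally show ?thesis using \<delta> by (simp add: \<delta>_def)
    qed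
    ultimately show ?thesis
      by (intro bexI[of _ S]) auto
  qed
qed

end

section \<open>Slices of an element of the bidual\<close>

context lp_isometry
begin

definition proj :: "'i \<Rightarrow> 'l \<Rightarrow>\<^sub>L 'l"
  where "proj i = blinfun_scaleR_left (unit_vec i) o\<^sub>L coord i"

definition coproj :: "'i \<Rightarrow> 'l \<Rightarrow>\<^sub>L 'l"
  where "coproj i = id_blinfun - proj i"

lemma proj_apply [simp]: "blinfun_apply (proj i) x = U x i *\<^sub>R unit_vec i"
  by (simp add: proj_def)

lemma coproj_apply [simp]: "blinfun_apply (coproj i) x = x - U x i *\<^sub>R unit_vec i"
  by (simp add: coproj_def blinfun.diff_left)

lemma coproj_coordinate:
  assumes "i \<in> I"
  shows "U (x - U x i *\<^sub>R unit_vec i) i = 0" "norm (x - U x i *\<^sub>R unit_vec i) \<le> norm x"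
proof -
  show 0: "U (x - U x i *\<^sub>R unit_vec i) i = 0"
    using assms by (simp add: U_diff U_scale U_unit)
  have "norm x powr p = \<bar>U x i\<bar> powr p + norm (x - U x i *\<^sub>R unit_vec i) powr p"
    using norm_disjoint_powr[OF assms 0, of "U x i"] by simp
  then show "norm (x - U x i *\<^sub>R unit_vec i) \<le> norm x"
    by (simp add: norm_le_iff_powr)
qed

text \<open>The part of \<open>\<phi>\<close> that sees only the coordinate \<open>i\<close> is an elementary tensor of functionals, so \<open>T\<close>
  evaluates it through a slice.\<close>

lemma functional_decomposition:
  fixes \<phi> :: "('l, 'a::real_normed_vector) inj_tensor dual"
  shows "blinfun_apply \<phi> z = blinfun_apply (blinfun_apply (form_of z) (coord i)) (\<phi> o\<^sub>L Blinfun (tensor (unit_vec i)))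
    + blinfun_apply \<phi> (tensor_map (coproj i) z)"
proof -
  have split: "z = tensor_map (proj i) z + tensor_map (coproj i) z"
  proof (rule inj_tensor_eqI)
    fix f :: "'l dual" and g :: "'a dual"
    have split: "f = (f o\<^sub>L proj i) + (f o\<^sub>L coproj i)"
      by (rule blinfun_eqI) (simp add: blinfun.add_left blinfun.diff_right)
    have "blinfun_apply (form_of z) f =
        blinfun_apply (form_of z) (f o\<^sub>L proj i) + blinfun_apply (form_of z) (f o\<^sub>L coproj i)"
      by (rule arg_cong[OF split, of "blinfun_apply (form_of z)", unfolded blinfun.add_right])
    then show "blinfun_apply (blinfun_apply (form_of z) f) g =
        blinfun_apply (blinfun_apply (form_of (tensor_map (proj i) z + tensor_map (coproj i) z)) f) g"
      by (simp add: form_of_add blinfun.add_left)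
  qed
  have "blinfun_apply \<phi> z = blinfun_apply \<phi> (tensor_map (proj i) z) + blinfun_apply \<phi> (tensor_map (coproj i) z)"
    by (rule arg_cong[OF split, of "blinfun_apply \<phi>", unfolded blinfun.add_right])
  moreover have "blinfun_apply \<phi> (tensor_map (proj i) z) =
      blinfun_apply (tensor_dual (coord i) (\<phi> o\<^sub>L Blinfun (tensor (unit_vec i)))) z"
  proof (induction z rule: inj_tensor_induct)
    case closed
    show ?case
      by (intro closed_Collect_eq linear_continuous_on bounded_linear_compose[OF blinfun.bounded_linear_right bounded_linear_tensor_map]
          blinfun.bounded_linear_right)
  next
    case (add u v)
    then show ?case
      by (simp only: linear_add[OF bounded_linear.linear[OF bounded_linear_tensor_map]] blinfun.add_right)
  next
    case (scale c u)
    then show ?case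
      by (simp only: linear_scale[OF bounded_linear.linear[OF bounded_linear_tensor_map]] blinfun.scaleR_right)
  next
    case (tensor x y)
    have "tensor (U x i *\<^sub>R unit_vec i) y = U x i *\<^sub>R tensor (unit_vec i) y"
      by (rule inj_tensor_eqI) (simp add: form_of_scale blinfun.scaleR_left blinfun.scaleR_right)
    then show ?case
      by (simp add: tensor_map_tensor blinfun.scaleR_right bounded_linear_Blinfun_apply[OF bounded_linear_tensor])
  qed
  ultimately show ?thesis by simp
qed

text \<open>The vectors \<open>unit_vec i\<close> and \<open>t *\<^sub>R (u - U u i *\<^sub>R unit_vec i)\<close> have disjoint supports, so their sum has norm
  at most \<open>(1 + t powr p) powr (1 / p)\<close> in \<open>\<ell>\<^sub>p\<close>.  The excess over \<open>1\<close> is of smaller order than \<open>t\<close>, and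
  this is the point of the estimate.\<close>

lemma upper_p_estimate:
  fixes z :: "('l, 'a::real_normed_vector) inj_tensor"
  assumes i: "i \<in> I" and x: "norm x \<le> 1" and z: "norm z \<le> 1" and t: "0 \<le> t"
  shows "norm (tensor (unit_vec i) x + t *\<^sub>R tensor_map (coproj i) z) \<le> 1 + t powr p"
proof (rule norm_inj_tensor_le)
  fix f :: "'l dual" and g :: "'a dual"
  define \<alpha> where "\<alpha> = blinfun_apply f (unit_vec i)"
  have dual: "norm (t *\<^sub>R (f o\<^sub>L coproj i)) \<le> (1 + t powr p) * norm f - \<bar>\<alpha>\<bar>"
  proof (rule norm_dual_le_of_unit_ball)
    fix u :: 'l assume u: "norm u \<le> 1"
    let ?u = "u - U u i *\<^sub>R unit_vec i"
    have unit: "norm (sgn \<alpha> *\<^sub>R unit_vec i + t *\<^sub>R ?u) \<le> 1 + t powr p"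
    proof -
      have "U (t *\<^sub>R ?u) i = 0"
        unfolding U_scale using coproj_coordinate(1)[OF i, of u] by simp
      then have "norm (sgn \<alpha> *\<^sub>R unit_vec i + t *\<^sub>R ?u) powr p = \<bar>sgn \<alpha>\<bar> powr p + (t * norm ?u) powr p"
        using norm_disjoint_powr[OF i] t by simp
      also have "\<dots> \<le> 1 + t powr p"
      proof (rule add_mono)
        show "\<bar>sgn \<alpha>\<bar> powr p \<le> 1" by (simp add: abs_sgn_eq)
        have "norm ?u \<le> 1" using coproj_coordinate(2)[OF i, of u] u by simp
        then show "(t * norm ?u) powr p \<le> t powr p"
          using t p by (intro powr_mono2) (auto simp: mult_left_le)
      qed
      also have "\<dots> \<le> (1 + t powr p) powr p"
        using powr_mono[of 1 p "1 + t powr p"] p by simp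
      finally show ?thesis by (subst norm_le_iff_powr) auto
    qed
    have "\<bar>\<alpha>\<bar> + t * blinfun_apply f ?u = blinfun_apply f (sgn \<alpha> *\<^sub>R unit_vec i + t *\<^sub>R ?u)"
      by (simp only: blinfun.add_right blinfun.scaleR_right flip: \<alpha>_def) (simp add: abs_sgn mult.commute)
    also have "\<dots> \<le> norm f * norm (sgn \<alpha> *\<^sub>R unit_vec i + t *\<^sub>R ?u)"
      using norm_blinfun[of f "sgn \<alpha> *\<^sub>R unit_vec i + t *\<^sub>R ?u"] by (simp only: real_norm_def abs_le_iff)
    also have "\<dots> \<le> norm f * (1 + t powr p)"
      by (intro mult_left_mono unit) simp
    finally have "t * blinfun_apply f ?u \<le> (1 + t powr p) * norm f - \<bar>\<alpha>\<bar>"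
      by (simp only: mult.commute[of "norm f"])
    then show "blinfun_apply (t *\<^sub>R (f o\<^sub>L coproj i)) u \<le> (1 + t powr p) * norm f - \<bar>\<alpha>\<bar>"
      by (simp only: blinfun.scaleR_left blinfun_apply_blinfun_compose coproj_apply real_scaleR_def)
  qed
  have "\<bar>blinfun_apply (blinfun_apply (form_of (tensor (unit_vec i) x + t *\<^sub>R tensor_map (coproj i) z)) f) g\<bar>
      = \<bar>\<alpha> * blinfun_apply g x + blinfun_apply (blinfun_apply (form_of z) (t *\<^sub>R (f o\<^sub>L coproj i))) g\<bar>"
    by (simp add: form_of_add form_of_scale blinfun.add_left blinfun.scaleR_left blinfun.scaleR_right \<alpha>_def)
  also have "\<dots> \<le> \<bar>\<alpha>\<bar> * norm g + norm (t *\<^sub>R (f o\<^sub>L coproj i)) * norm g"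
  proof (rule order_trans[OF abs_triangle_ineq add_mono])
    have "\<bar>blinfun_apply g x\<bar> \<le> norm g"
      using norm_blinfun[of g x] mult_left_le[OF x, of "norm g"] by simp
    then show "\<bar>\<alpha> * blinfun_apply g x\<bar> \<le> \<bar>\<alpha>\<bar> * norm g"
      by (simp add: abs_mult mult_left_mono)
    have "norm z * norm (t *\<^sub>R (f o\<^sub>L coproj i)) * norm g \<le> 1 * norm (t *\<^sub>R (f o\<^sub>L coproj i)) * norm g"
      using z by (intro mult_right_mono) auto
    then show "\<bar>blinfun_apply (blinfun_apply (form_of z) (t *\<^sub>R (f o\<^sub>L coproj i))) g\<bar> \<le> norm (t *\<^sub>R (f o\<^sub>L coproj i)) * norm g"
      using form_of_le(2)[of z "t *\<^sub>R (f o\<^sub>L coproj i)" g] by linarith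
  qed
  also have "\<dots> \<le> \<bar>\<alpha>\<bar> * norm g + ((1 + t powr p) * norm f - \<bar>\<alpha>\<bar>) * norm g"
    by (intro add_left_mono mult_right_mono dual) simp
  also have "\<dots> = (1 + t powr p) * norm f * norm g"
    by (simp add: algebra_simps)
  finally show "\<bar>blinfun_apply (blinfun_apply (form_of (tensor (unit_vec i) x + t *\<^sub>R tensor_map (coproj i) z)) f) g\<bar>
      \<le> (1 + t powr p) * norm f * norm g" .
qed (use t p in simp)

text \<open>Let \<open>\<phi>\<close> almost norm both \<open>T\<close> and \<open>e\<^sub>i \<otimes> x\<close>, with error \<open>t powr p\<close>.  By \<open>upper_p_estimate\<close> the part of \<open>\<phi>\<close>
  that ignores the coordinate \<open>i\<close> has norm of order \<open>t powr (p - 1)\<close>.  Hence \<open>T\<close> is almost normed by the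
  other part, on which it acts as a slice.\<close>

lemma norm_slice_coord_ge:
  fixes T :: "('l, 'a::real_normed_vector) inj_tensor bidual"
  assumes i: "i \<in> I" and T: "norm T = 1" and x: "norm x = 1"
    and two: "norm (T + bidual_embed (tensor (unit_vec i) x)) = 2"
  shows "1 \<le> norm (slice T (coord i))"
proof -
  let ?S = "tensor (unit_vec i) x"
  have main: "1 - 3 * t powr (p - 1) \<le> norm (slice T (coord i))" if t: "0 < t" "t \<le> 1" for t
  proof -
    have tp: "t powr p = t * t powr (p - 1)"
      using t powr_add[of t 1 "p - 1"] by simp
    have "\<exists>\<phi>. norm \<phi> \<le> 1 \<and> 2 - t powr p < blinfun_apply (T + bidual_embed ?S) \<phi>"
    proof (rule ccontr)
      assume "\<not> ?thesis"
      then have "blinfun_apply (T + bidual_embed ?S) \<phi> \<le> 2 - t powr p" if "norm \<phi> \<le> 1" for \<phi>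
        using that by (auto simp: not_less)
      then have "norm (T + bidual_embed ?S) \<le> 2 - t powr p"
        by (rule norm_dual_le_of_unit_ball)
      then show False using two t by simp
    qed
    then obtain \<phi> where \<phi>: "norm \<phi> \<le> 1" "2 - t powr p < blinfun_apply T \<phi> + blinfun_apply \<phi> ?S"
      by (auto simp: blinfun.add_left)
    have \<phi>_le: "blinfun_apply \<phi> z \<le> norm z" for z
    proof -
      have "blinfun_apply \<phi> z \<le> norm \<phi> * norm z"
        using norm_blinfun[of \<phi> z] by simp
      also have "\<dots> \<le> 1 * norm z"
        using \<phi>(1) by (intro mult_right_mono) auto
      finally show ?thesis by simp
    qed
    have "norm ?S \<le> 1"
      using norm_tensor_le[of "unit_vec i" x] norm_unit[OF i] x by simp
    then have S1: "blinfun_apply \<phi> ?S \<le> 1"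
      using \<phi>_le[of ?S] by simp
    have T1: "\<bar>blinfun_apply T \<psi>\<bar> \<le> norm \<psi>" for \<psi>
      using norm_blinfun[of T \<psi>] T by simp
    \<comment> \<open>The part that ignores the coordinate i.\<close>
    define \<rho> where "\<rho> = \<phi> o\<^sub>L Blinfun (tensor_map (coproj i))"
    have \<rho>: "blinfun_apply \<rho> z = blinfun_apply \<phi> (tensor_map (coproj i) z)" for z
      unfolding \<rho>_def by (simp add: bounded_linear_Blinfun_apply[OF bounded_linear_tensor_map])
    have "norm \<rho> \<le> 2 * t powr (p - 1)"
    proof (rule norm_dual_le_of_unit_ball)
      fix z :: "('l, 'a) inj_tensor" assume z: "norm z \<le> 1"
      have "blinfun_apply \<phi> ?S + t * blinfun_apply \<rho> z = blinfun_apply \<phi> (?S + t *\<^sub>R tensor_map (coproj i) z)"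
        by (simp add: \<rho> blinfun.add_right blinfun.scaleR_right)
      also have "\<dots> \<le> 1 + t powr p"
      proof (rule order_trans[OF \<phi>_le])
        show "norm (?S + t *\<^sub>R tensor_map (coproj i) z) \<le> 1 + t powr p"
          by (rule upper_p_estimate[OF i _ z]) (use x t in simp_all)
      qed
      finally have "t * blinfun_apply \<rho> z \<le> 2 * t powr p"
        using \<phi>(2) T1[of \<phi>] \<phi>(1) by linarith
      also have "\<dots> = t * (2 * t powr (p - 1))"
        unfolding tp by (rule mult.left_commute)
      finally show "blinfun_apply \<rho> z \<le> 2 * t powr (p - 1)"
        using t(1) by (simp only: mult_le_cancel_left_pos)
    qed
    then have T\<rho>: "blinfun_apply T \<rho> \<le> 2 * t powr (p - 1)"
      using T1[of \<rho>] by simp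
    define g where "g = \<phi> o\<^sub>L Blinfun (tensor (unit_vec i))"
    have g: "norm g \<le> 1"
    proof (rule norm_dual_le_of_unit_ball)
      fix y :: 'a assume "norm y \<le> 1"
      then show "blinfun_apply g y \<le> 1"
        using \<phi>_le[of "tensor (unit_vec i) y"] norm_tensor_le[of "unit_vec i" y] norm_unit[OF i]
        by (simp add: g_def bounded_linear_Blinfun_apply[OF bounded_linear_tensor])
    qed
    have "\<phi> = tensor_dual (coord i) g + \<rho>"
      by (rule blinfun_eqI) (unfold blinfun.add_left tensor_dual_apply \<rho> g_def, rule functional_decomposition)
    then have "blinfun_apply T \<phi> = blinfun_apply T (tensor_dual (coord i) g + \<rho>)"
      by (rule arg_cong)
    then have "blinfun_apply T \<phi> = blinfun_apply (slice T (coord i)) g + blinfun_apply T \<rho>"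
      unfolding blinfun.add_right slice_apply .
    moreover have "blinfun_apply (slice T (coord i)) g \<le> norm (slice T (coord i))"
    proof -
      have "blinfun_apply (slice T (coord i)) g \<le> norm (slice T (coord i)) * norm g"
        using norm_blinfun[of "slice T (coord i)" g] by (simp del: slice_apply)
      also have "\<dots> \<le> norm (slice T (coord i))"
        using g by (intro mult_left_le) auto
      finally show ?thesis .
    qed
    moreover have "t powr p \<le> t powr (p - 1)"
      unfolding tp using t by (intro mult_left_le_one_le) auto
    ultimately show ?thesis
      using T\<rho> S1 \<phi>(2) by linarith
  qed
  show ?thesis
  proof (rule field_le_epsilon)
    fix e :: real assume e: "0 < e"
    define s where "s = min 1 (e / 3)"
    have s: "0 < s" "s \<le> 1" "3 * s \<le> e" using e by (auto simp: s_def)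
    have "(s powr (1 / (p - 1))) powr (p - 1) = s"
      using s p by (simp add: powr_powr)
    moreover have "s powr (1 / (p - 1)) \<le> 1"
      using s p powr_mono2[of "1 / (p - 1)" s 1] by simp
    ultimately show "1 \<le> norm (slice T (coord i)) + e"
      using main[of "s powr (1 / (p - 1))"] s by simp
  qed
qed

lemma norm_sum_slices_le:
  fixes T :: "('l, 'a::real_normed_vector) inj_tensor bidual"
  assumes "finite F" "F \<subseteq> I"
  shows "norm (\<Sum>i\<in>F. slice T (coord i)) \<le> norm T * real (card F) powr (1 - 1 / p)"
proof -
  have "norm (\<Sum>i\<in>F. coord i) \<le> real (card F) powr (1 - 1 / p)"
    by (rule norm_blinfun_bound) (use sum_coord_le[OF assms] in \<open>simp_all add: blinfun.sum_left\<close>)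
  then show ?thesis
    unfolding slice_sum[symmetric]
    by (intro order_trans[OF norm_slice_le] mult_left_mono) auto
qed

end

section \<open>Many slices near one vector\<close>

lemma infinite_fibre:
  assumes I: "infinite I" and D: "|D| <o |I|" and d: "\<And>i. i \<in> I \<Longrightarrow> d i \<in> D"
  obtains y where "infinite {i \<in> I. d i = y}"
proof -
  have "\<exists>y\<in>D. infinite {i \<in> I. d i = y}"
  proof (rule ccontr)
    assume "\<not> ?thesis"
    then have fin: "\<forall>y\<in>D. finite {i \<in> I. d i = y}" by blast
    have U: "I = (\<Union>y\<in>D. {i \<in> I. d i = y})" using d by blast
    show False
    proof (cases "finite D")
      case True
      then have "finite (\<Union>y\<in>D. {i \<in> I. d i = y})" using fin by blast
      then show False using U I by simp
    next
      case False
      have "\<forall>y\<in>D. |{i \<in> I. d i = y}| \<le>o |D|"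
        using fin False card_of_ordLeq_finite ordLeq_total[OF card_of_Well_order card_of_Well_order] by blast
      then have "|\<Union>y\<in>D. {i \<in> I. d i = y}| \<le>o |D|"
        by (intro card_of_UNION_ordLeq_infinite[OF False card_of_mono1[OF subset_refl]])
      then have "|I| \<le>o |D|" using U by simp
      then show False using D not_ordLess_ordLeq by blast
    qed
  qed
  then show ?thesis using that by blast
qed

theorem theorem3p2:
  fixes I :: "'i set" and p :: real
    and U :: "'l::banach \<Rightarrow> 'i \<Rightarrow> real"
  assumes "octahedral TYPE('a::banach)"
    and "infinite I"
    and "density_character TYPE('a bidual) <o |I|"
    and "2 < p"
    and "is_lp_space I p U"
  shows "octahedral TYPE(('l, 'a) inj_tensor) \<and>
    \<not> (\<exists>T :: ('l, 'a) inj_tensor bidual.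
         norm T = 1 \<and>
         (\<forall>S :: ('l, 'a) inj_tensor. norm (T + bidual_embed S) = 1 + norm S))"
proof (intro conjI notI)
  interpret lp_isometry I p U
    by unfold_locales (use assms in auto)
  show "octahedral TYPE(('l, 'a) inj_tensor)"
    using assms(1,4) by (rule octahedral_inj_tensor)
  assume "\<exists>T :: ('l, 'a) inj_tensor bidual. norm T = 1 \<and>
    (\<forall>S :: ('l, 'a) inj_tensor. norm (T + bidual_embed S) = 1 + norm S)"
  then obtain T :: "('l, 'a) inj_tensor bidual"
    where T: "norm T = 1" "\<And>S. norm (T + bidual_embed S) = 1 + norm S" by blast
  have "\<exists>x::'a. norm x = 1"
  proof (rule ccontr)
    assume "\<not> ?thesis"
    then have trivial: "z = 0" for z :: "('l, 'a) inj_tensor"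
      using inj_tensor_trivial by blast
    have "\<psi> = 0" for \<psi> :: "('l, 'a) inj_tensor dual"
    proof (rule blinfun_eqI)
      show "blinfun_apply \<psi> z = blinfun_apply 0 z" for z
        using trivial[of z] by (simp add: blinfun.zero_right)
    qed
    then have "blinfun_apply T \<psi> = blinfun_apply T 0" for \<psi>
      by (rule arg_cong)
    then have "T = 0"
      by (intro blinfun_eqI) (simp only: blinfun.zero_right blinfun.zero_left)
    then show False using T(1) by simp
  qed
  then obtain x :: 'a where x: "norm x = 1" by blast
  have slice_ge: "1 \<le> norm (slice T (coord i))" if i: "i \<in> I" for i
  proof (rule norm_slice_coord_ge[OF i T(1) x])
    obtain f :: "'l dual" where f: "norm f \<le> 1" "blinfun_apply f (unit_vec i) = norm (unit_vec i)"
      by (rule norming_functional)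
    obtain g :: "'a dual" where g: "norm g \<le> 1" "blinfun_apply g x = norm x"
      by (rule norming_functional)
    have "1 \<le> norm (tensor (unit_vec i) x) * norm f * norm g"
      using form_of_le(2)[of "tensor (unit_vec i) x" f g] f(2) g(2) x norm_unit[OF i] by simp
    also have "\<dots> \<le> norm (tensor (unit_vec i) x) * 1 * 1"
      using f g by (intro mult_mono) auto
    finally have "norm (tensor (unit_vec i) x) = 1"
      using norm_tensor_le[of "unit_vec i" x] norm_unit[OF i] x by simp
    then show "norm (T + bidual_embed (tensor (unit_vec i) x)) = 2"
      using T(2) by simp
  qed
  from density_character_ex[where 'a = "'a bidual"]
  obtain D :: "'a bidual set" where dens: "density_character TYPE('a bidual) = |D|" "closure D = UNIV"
    by (elim exE conjE) (rule that)
  have D: "|D| <o |I|" "closure D = UNIV"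
    using assms(3) dens(2) unfolding dens(1) by this
  have near_D: "\<exists>y\<in>D. dist y (slice T (coord i)) < 1 / 4" for i
  proof (rule closure_approachable[THEN iffD1, rule_format])
    show "slice T (coord i) \<in> closure D" using D(2) by simp
  qed simp
  define d where "d i = (SOME y. y \<in> D \<and> dist y (slice T (coord i)) < 1 / 4)" for i
  have choice: "d i \<in> D \<and> dist (d i) (slice T (coord i)) < 1 / 4" for i
    unfolding d_def by (rule someI_ex) (use near_D[of i] in blast)
  note d = conjunct1[OF choice] conjunct2[OF choice]
  obtain y where y: "infinite {i \<in> I. d i = y}"
    by (rule infinite_fibre[OF assms(2) D(1)]) (rule d(1))
  \<comment> \<open>With this many slices near y the bound n powr (1 - 1/p) falls below n/2.\<close>
  define n where "n = Suc (nat \<lceil>2 powr p\<rceil>)"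
  have n: "2 powr p < real n" unfolding n_def by linarith
  obtain F where F: "F \<subseteq> {i \<in> I. d i = y}" "finite F" "card F = n"
    using infinite_arbitrarily_large[OF y, of n] by auto
  have FI: "F \<subseteq> I" using F(1) by blast
  have near: "norm (slice T (coord i) - y) \<le> 1 / 4" if "i \<in> F" for i
  proof -
    have "d i = y" using F(1) that by blast
    then have "dist y (slice T (coord i)) < 1 / 4" using d(2)[of i] by simp
    then show ?thesis unfolding dist_norm norm_minus_commute[of y] by (rule less_imp_le)
  qed
  have "F \<noteq> {}" using F(3) by (auto simp: n_def)
  then obtain i0 where i0: "i0 \<in> F" by blast
  have y_ge: "3 / 4 \<le> norm y"
    using norm_triangle_ineq2[of "slice T (coord i0)" y] near[OF i0] slice_ge[OF subsetD[OF FI i0]]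
    by linarith
  have "real n * norm y = norm (\<Sum>i\<in>F. y)"
    using F(3) by (simp add: sum_constant_scaleR)
  also have "\<dots> = norm ((\<Sum>i\<in>F. slice T (coord i)) - (\<Sum>i\<in>F. slice T (coord i) - y))"
    by (simp add: sum_subtractf)
  also have "\<dots> \<le> norm (\<Sum>i\<in>F. slice T (coord i)) + norm (\<Sum>i\<in>F. slice T (coord i) - y)"
    by (rule norm_triangle_ineq4)
  also have "\<dots> \<le> real n powr (1 - 1 / p) + real n * (1 / 4)"
  proof (rule add_mono)
    show "norm (\<Sum>i\<in>F. slice T (coord i)) \<le> real n powr (1 - 1 / p)"
      using norm_sum_slices_le[OF F(2) FI, of T] T(1) F(3) by simp
    show "norm (\<Sum>i\<in>F. slice T (coord i) - y) \<le> real n * (1 / 4)"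
      using sum_norm_bound[of F "\<lambda>i. slice T (coord i) - y" "1 / 4"] near F(3) by simp
  qed
  finally have "real n * (3 / 4) \<le> real n powr (1 - 1 / p) + real n * (1 / 4)"
    using mult_left_mono[OF y_ge, of "real n"] by linarith
  then have "real n \<le> 2 * real n powr (1 - 1 / p)" by simp
  moreover have "2 < real n powr (1 / p)"
  proof -
    have "(2 powr p) powr (1 / p) < real n powr (1 / p)"
      using n p by (intro powr_less_mono2) auto
    then show ?thesis using p by (simp add: powr_powr)
  qed
  then have "2 * real n powr (1 - 1 / p) < real n powr (1 / p) * real n powr (1 - 1 / p)"
    by (intro mult_strict_right_mono) (auto simp: n_def)
  moreover have "real n powr (1 / p) * real n powr (1 - 1 / p) = real n"
    using powr_add[of "real n" "1 / p" "1 - 1 / p"] by simp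
  ultimately show False by linarith
qed

end
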